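(* Let $\mathcal{K}$ be a finite vertex-describable abstract $(n-1)$-polytope with $v$ vertices. Then $2^{\mathcal{K}}$ is a finite abstract $n$-polytope with the following properties. (a) If $\mathcal{K}$ is a $k$-orbit polytope for some $k\ge 1$, then $2^{\mathcal{K}}$ is also a $k$-orbit polytope. (b) If $\mathcal{K}$ is regular, then $2^{\mathcal{K}}$ is regular. (c) If $\mathcal{K}$ is a $2$-orbit polytope in class $2_I$ for some $I\subseteq\{0,\ldots,n-2\}$, then $2^{\mathcal{K}}$ is a $2$-orbit polytope in class $2_J$ where $J=\{0\}\cup\{i+1: i\in I\}$. (d) If $\mathcal{K}$ is chiral, then $2^{\mathcal{K}}$ is a $2$-orbit polytope in class $2_{\{0\}}$.
   Context: An abstract $m$-polytope is a partially ordered set with a strictly monotone rank function onto $\{-1,\ldots,m\}$, with least and greatest faces, all flags (maximal chains) of size $m+2$, strongly flag-connected, and satisfying the diamond condition. For a flag $\Phi$, $\Phi^i$ is the unique flag differing from $\Phi$ exactly in its $i$-face. A polytope is a $k$-orbit polytope if its automorphism group has exactly $k$ flag-orbits; regular means $1$-orbit; chiral means $2$-orbit with adjacent flags in different orbits; a $2$-orbit polytope is in class $2_I$ if $\Phi$ and $\Phi^i$ lie in the same orbit exactly when $i\in I$. A polytope is vertex-describable if each face is uniquely determined by its set of vertices. Construction $2^{\mathcal{K}}$: identify the vertex set of $\mathcal{K}$ with $V=\{1,\ldots,v\}$ and each face of $\mathcal{K}$ with its vertex set. The faces of $2^{\mathcal{K}}$ are the empty set (rank $-1$) and, for each $(j-1)$-face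 $F$ of $\mathcal{K}$ ($0\le j\le n$, with $F=\emptyset$ for $j=0$ and $F=V$ for $j=n$) and each $\varepsilon=(\varepsilon_1,\ldots,\varepsilon_v)\in\{0,1\}^v$, the set $F(\varepsilon)=\{\eta\in\{0,1\}^v:\eta_i=\varepsilon_i \text{ for all } i\notin F\}$, of rank $j$; faces are ordered by inclusion. Thus the vertices of $2^{\mathcal{K}}$ are the singletons $\{\varepsilon\}$, and all vertex-figures of $2^{\mathcal{K}}$ are isomorphic to $\mathcal{K}$.
   Formalization: Vertex-describable is taken to mean that faces have distinct vertex sets and also that incidence in K is inclusion of vertex sets; with distinctness alone the claim fails, e.g. for the toroidal map {4,4}_(2,1), where 2^K violates the diamond condition. *)

theory Defs
  imports Main "HOL-Library.FuncSet"
begin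

section \<open>Abstract polytopes\<close>

record 'a ranked_poset =
  faces :: "'a set"
  face_le :: "'a \<Rightarrow> 'a \<Rightarrow> bool"
  face_rank :: "'a \<Rightarrow> int"

definition face_less :: "'a ranked_poset \<Rightarrow> 'a \<Rightarrow> 'a \<Rightarrow> bool" where
  "face_less K F G \<longleftrightarrow> face_le K F G \<and> F \<noteq> G"

definition flags :: "'a ranked_poset \<Rightarrow> 'a set set" where
  "flags K = {\<Phi>. pred_on.maxchain (faces K) (face_le K) \<Phi>}"

definition adjacent_flags :: "'a set \<Rightarrow> 'a set \<Rightarrow> bool" where
  "adjacent_flags \<Phi> \<Psi> \<longleftrightarrow> card (\<Phi> - \<Psi>) = 1 \<and> card (\<Psi> - \<Phi>) = 1"

definition strongly_flag_connected :: "'a ranked_poset \<Rightarrow> bool" where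
  "strongly_flag_connected K \<longleftrightarrow>
    (\<forall>\<Phi>\<in>flags K. \<forall>\<Psi>\<in>flags K. \<exists>(c :: nat \<Rightarrow> 'a set) l.
       c 0 = \<Phi> \<and> c l = \<Psi> \<and>
       (\<forall>t\<le>l. c t \<in> flags K \<and> \<Phi> \<inter> \<Psi> \<subseteq> c t) \<and>
       (\<forall>t<l. adjacent_flags (c t) (c (Suc t))))"

definition diamond_condition :: "'a ranked_poset \<Rightarrow> bool" where
  "diamond_condition K \<longleftrightarrow>
    (\<forall>F\<in>faces K. \<forall>G\<in>faces K. face_less K F G \<and> face_rank K G = face_rank K F + 2 \<longrightarrow>
       card {H \<in> faces K. face_less K F H \<and> face_less K H G} = 2)"

definition abstract_polytope :: "int \<Rightarrow> 'a ranked_poset \<Rightarrow> bool" where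
  "abstract_polytope m K \<longleftrightarrow>
    reflp_on (faces K) (face_le K) \<and>
    antisymp_on (faces K) (face_le K) \<and>
    transp_on (faces K) (face_le K) \<and>
    monotone_on (faces K) (face_less K) (<) (face_rank K) \<and>
    face_rank K ` faces K = {-1..m} \<and>
    (\<exists>F\<in>faces K. \<forall>G\<in>faces K. face_le K F G) \<and>
    (\<exists>F\<in>faces K. \<forall>G\<in>faces K. face_le K G F) \<and>
    (\<forall>\<Phi>\<in>flags K. int (card \<Phi>) = m + 2) \<and>
    strongly_flag_connected K \<and>
    diamond_condition K"

section \<open>Flag orbits\<close>

definition automorphisms :: "'a ranked_poset \<Rightarrow> ('a \<Rightarrow> 'a) set" where
  "automorphisms K =
    {\<gamma>. bij_betw \<gamma> (faces K) (faces K) \<and>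
        (\<forall>F\<in>faces K. \<forall>G\<in>faces K. face_le K (\<gamma> F) (\<gamma> G) \<longleftrightarrow> face_le K F G)}"

definition flag_orbit :: "'a ranked_poset \<Rightarrow> 'a set \<Rightarrow> 'a set set" where
  "flag_orbit K \<Phi> = {\<gamma> ` \<Phi> | \<gamma>. \<gamma> \<in> automorphisms K}"

definition flag_orbits :: "'a ranked_poset \<Rightarrow> 'a set set set" where
  "flag_orbits K = flag_orbit K ` flags K"

definition orbit_polytope :: "int \<Rightarrow> nat \<Rightarrow> 'a ranked_poset \<Rightarrow> bool" where
  "orbit_polytope m k K \<longleftrightarrow>
    abstract_polytope m K \<and> finite (flag_orbits K) \<and> card (flag_orbits K) = k"

definition regular_polytope :: "int \<Rightarrow> 'a ranked_poset \<Rightarrow> bool" where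
  "regular_polytope m K \<longleftrightarrow> orbit_polytope m 1 K"

definition chiral_polytope :: "int \<Rightarrow> 'a ranked_poset \<Rightarrow> bool" where
  "chiral_polytope m K \<longleftrightarrow> orbit_polytope m 2 K \<and>
    (\<forall>\<Phi>\<in>flags K. \<forall>\<Psi>\<in>flags K. adjacent_flags \<Phi> \<Psi> \<longrightarrow> \<Psi> \<notin> flag_orbit K \<Phi>)"

text \<open>The flag \<open>\<Phi>\<^sup>i\<close>; it exists uniquely for \<open>0 \<le> i < m\<close> in an abstract \<open>m\<close>-polytope.\<close>

definition adj_flag :: "'a ranked_poset \<Rightarrow> int \<Rightarrow> 'a set \<Rightarrow> 'a set" where
  "adj_flag K i \<Phi> =
    (THE \<Psi>. \<Psi> \<in> flags K \<and> \<Psi> \<noteq> \<Phi> \<and>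
       {F \<in> \<Psi>. face_rank K F \<noteq> i} = {F \<in> \<Phi>. face_rank K F \<noteq> i})"

definition in_class_two :: "int \<Rightarrow> int set \<Rightarrow> 'a ranked_poset \<Rightarrow> bool" where
  "in_class_two m I K \<longleftrightarrow> orbit_polytope m 2 K \<and> I \<subseteq> {0..m - 1} \<and>
    (\<forall>\<Phi>\<in>flags K. \<forall>i\<in>{0..m - 1}. adj_flag K i \<Phi> \<in> flag_orbit K \<Phi> \<longleftrightarrow> i \<in> I)"

section \<open>The polytope \<open>2\<^sup>K\<close>\<close>

definition vertices :: "'a ranked_poset \<Rightarrow> 'a set" where
  "vertices K = {x \<in> faces K. face_rank K x = 0}"

definition vertex_set :: "'a ranked_poset \<Rightarrow> 'a \<Rightarrow> 'a set" where
  "vertex_set K F = {x \<in> vertices K. face_le K x F}"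

text \<open>
  Faces are identified with their vertex sets as elements of a poset: the map from faces to
  vertex sets is injective and incidence is inclusion. Injectivity alone would not suffice for
  \<open>2\<^sup>K\<close>, which is ordered by inclusion: in the toroidal map \<open>{4,4}\<close> with 5 vertices
  (whose graph is complete) distinct faces have distinct vertex sets, but both diagonals of each
  square are edges not incident with it, and \<open>2\<^sup>K\<close> fails the diamond condition.
\<close>

definition vertex_describable :: "'a ranked_poset \<Rightarrow> bool" where
  "vertex_describable K \<longleftrightarrow>
    inj_on (vertex_set K) (faces K) \<and>
    (\<forall>F\<in>faces K. \<forall>G\<in>faces K. face_le K F G \<longleftrightarrow> vertex_set K F \<subseteq> vertex_set K G)"

definition cube :: "nat \<Rightarrow> (nat \<Rightarrow> nat) set" where
  "cube v = {1..v} \<rightarrow>\<^sub>E {0, 1}"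

definition subcube :: "nat \<Rightarrow> nat set \<Rightarrow> (nat \<Rightarrow> nat) \<Rightarrow> (nat \<Rightarrow> nat) set" where
  "subcube v S \<epsilon> = {\<eta> \<in> cube v. \<forall>i\<in>{1..v} - S. \<eta> i = \<epsilon> i}"

text \<open>
  The labelling \<open>lab\<close>, meant to be a bijection from the vertices of \<open>K\<close> onto \<open>{1..v}\<close>, makes the
  identification of the vertex set with \<open>{1..v}\<close> explicit. The least and greatest faces of \<open>K\<close>
  need no special treatment: their vertex sets are empty and full, respectively.
\<close>

definition two_power :: "nat \<Rightarrow> ('a \<Rightarrow> nat) \<Rightarrow> 'a ranked_poset \<Rightarrow> (nat \<Rightarrow> nat) set ranked_poset" where
  "two_power v lab K =
    \<lparr> faces = insert {}
        {subcube v (lab ` vertex_set K F) \<epsilon> | F \<epsilon>. F \<in> faces K \<and> \<epsilon> \<in> cube v},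
      face_le = (\<subseteq>),
      face_rank = (\<lambda>X. if X = {} then -1 else
        THE j. \<exists>F\<in>faces K. \<exists>\<epsilon>\<in>cube v.
          X = subcube v (lab ` vertex_set K F) \<epsilon> \<and> j = face_rank K F + 1) \<rparr>"

end

theory Submission
  imports Defs
begin

text \<open>A nonempty face of \<open>2\<^sup>K\<close> is determined by any one of its points together with a face of \<open>K\<close>,
  and inclusion of faces with a common point is incidence in \<open>K\<close>. As every flag of \<open>2\<^sup>K\<close> starts with a
  single point \<open>\<epsilon>\<close>, flags of \<open>2\<^sup>K\<close> are pairs \<open>(\<epsilon>, \<Phi>)\<close> with \<open>\<Phi>\<close> a flag of \<open>K\<close>; exchanging the
  vertex flips one coordinate of \<open>\<epsilon>\<close>, and exchanging the \<open>(i + 1)\<close>-face replaces \<open>\<Phi>\<close> by \<open>\<Phi>\<^sup>i\<close>.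
  Translations of the cube act transitively on its points, automorphisms of \<open>K\<close> act by permuting
  coordinates, and conversely an automorphism of \<open>2\<^sup>K\<close> that maps \<open>\<epsilon>\<close> to \<open>\<eta>\<close> induces an isomorphism
  between the vertex-figures, which are both copies of \<open>K\<close>. Hence \<open>(\<epsilon>, \<Phi>)\<close> and \<open>(\<eta>, \<Psi>)\<close> lie in one
  orbit if and only if \<open>\<Phi>\<close> and \<open>\<Psi>\<close> do.\<close>

section \<open>Flags of abstract polytopes\<close>

text \<open>\<open>pred_on.chain\<close> compares faces by the reflexive closure of the relation.
  For a reflexive \<open>face_le\<close> the closure adds nothing, which leaves this plain
  form.\<close>

definition face_chain :: "'a ranked_poset \<Rightarrow> 'a set \<Rightarrow> bool" where
  "face_chain K C \<longleftrightarrow> C \<subseteq> faces K \<and> (\<forall>F\<in>C. \<forall>G\<in>C. face_le K F G \<or> face_le K G F)"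

lemma face_chainD:
  "face_chain K C \<Longrightarrow> F \<in> C \<Longrightarrow> G \<in> C \<Longrightarrow> face_le K F G \<or> face_le K G F"
  by (simp add: face_chain_def)

lemma flags_eq_maximal:
  assumes "reflp_on (faces K) (face_le K)"
  shows "flags K = {\<Phi>. face_chain K \<Phi> \<and> (\<forall>C. face_chain K C \<longrightarrow> \<not> \<Phi> \<subset> C)}"
proof -
  have "pred_on.chain (faces K) (face_le K) C \<longleftrightarrow> face_chain K C" for C
    using assms unfolding pred_on.chain_def face_chain_def reflp_on_def by blast
  then show ?thesis
    by (auto simp: flags_def pred_on.maxchain_def)
qed

text \<open>Maximality can be tested one face at a time: a strictly larger chain supplies a further
  face comparable with all of \<Phi>, and any such face extends the chain \<Phi>.\<close>

lemma flags_iff: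
  assumes refl: "reflp_on (faces K) (face_le K)"
  shows "\<Phi> \<in> flags K \<longleftrightarrow> face_chain K \<Phi> \<and>
    (\<forall>H\<in>faces K. (\<forall>F\<in>\<Phi>. face_le K F H \<or> face_le K H F) \<longrightarrow> H \<in> \<Phi>)" (is "_ \<longleftrightarrow> ?R")
proof
  assume \<Phi>: "\<Phi> \<in> flags K"
  have "H \<in> \<Phi>" if H: "H \<in> faces K" "\<forall>F\<in>\<Phi>. face_le K F H \<or> face_le K H F" for H
  proof -
    have "face_chain K (insert H \<Phi>)"
      using \<Phi> H refl by (auto simp: flags_eq_maximal[OF refl] face_chain_def reflp_on_def)
    then show ?thesis
      using \<Phi> by (auto simp: flags_eq_maximal[OF refl])
  qed
  then show ?R
    using \<Phi> by (simp add: flags_eq_maximal[OF refl])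
next
  assume R: ?R
  have "\<not> \<Phi> \<subset> C" if C: "face_chain K C" for C
  proof
    assume "\<Phi> \<subset> C"
    then obtain H where "H \<in> C" "H \<notin> \<Phi>" "\<Phi> \<subseteq> C" by blast
    then show False using R C unfolding face_chain_def by blast
  qed
  then show "\<Phi> \<in> flags K"
    using R by (simp add: flags_eq_maximal[OF refl])
qed

text \<open>A finite poset has finitely many chains, so one that is maximal for inclusion lies above
  \<open>C\<close>.\<close>

lemma face_chain_extends_to_flag:
  assumes refl: "reflp_on (faces K) (face_le K)" and fin: "finite (faces K)"
    and C: "face_chain K C"
  obtains \<Phi> where "\<Phi> \<in> flags K" "C \<subseteq> \<Phi>"
proof -
  have "finite {C. face_chain K C}"
    by (rule finite_subset[of _ "Pow (faces K)"]) (auto simp: face_chain_def fin)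
  then obtain \<Phi> where "face_chain K \<Phi>" "C \<subseteq> \<Phi>" "\<forall>D. face_chain K D \<longrightarrow> \<Phi> \<subseteq> D \<longrightarrow> \<Phi> = D"
    using finite_has_maximal2[of "{C. face_chain K C}" C] C by auto
  then show ?thesis
    using that[of \<Phi>] unfolding flags_eq_maximal[OF refl] by blast
qed

lemma face_chain_image:
  assumes "face_chain K C" "\<gamma> \<in> automorphisms K"
  shows "face_chain K (\<gamma> ` C)"
proof -
  have b: "bij_betw \<gamma> (faces K) (faces K)"
    and le: "\<And>F G. F \<in> faces K \<Longrightarrow> G \<in> faces K \<Longrightarrow> face_le K (\<gamma> F) (\<gamma> G) \<longleftrightarrow> face_le K F G"
    using assms(2) by (auto simp: automorphisms_def)
  show ?thesis
    using assms(1) bij_betw_imp_surj_on[OF b] le unfolding face_chain_def by blast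
qed

lemma automorphism_image_flag:
  assumes refl: "reflp_on (faces K) (face_le K)"
    and \<Phi>: "\<Phi> \<in> flags K" and \<gamma>: "\<gamma> \<in> automorphisms K"
  shows "\<gamma> ` \<Phi> \<in> flags K"
proof -
  have b: "bij_betw \<gamma> (faces K) (faces K)"
    and le: "\<And>F G. F \<in> faces K \<Longrightarrow> G \<in> faces K \<Longrightarrow> face_le K (\<gamma> F) (\<gamma> G) \<longleftrightarrow> face_le K F G"
    using \<gamma> by (auto simp: automorphisms_def)
  have sub: "\<Phi> \<subseteq> faces K" using \<Phi> by (simp add: flags_iff[OF refl] face_chain_def)
  have "H \<in> \<gamma> ` \<Phi>"
    if H: "H \<in> faces K" "\<forall>F\<in>\<gamma> ` \<Phi>. face_le K F H \<or> face_le K H F" for H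
  proof -
    obtain G where G: "G \<in> faces K" "H = \<gamma> G"
      using H(1) bij_betw_imp_surj_on[OF b] by blast
    have "\<forall>F\<in>\<Phi>. face_le K F G \<or> face_le K G F"
      using H(2) G sub le by blast
    then show ?thesis
      using \<Phi> G by (auto simp: flags_iff[OF refl])
  qed
  then show ?thesis
    using face_chain_image[OF _ \<gamma>] \<Phi> by (auto simp: flags_iff[OF refl])
qed

lemma flag_orbit_refl: "\<Phi> \<in> flag_orbit K \<Phi>"
proof -
  have "id \<in> automorphisms K" by (simp add: automorphisms_def)
  then show ?thesis unfolding flag_orbit_def by (metis (mono_tags, lifting) image_id id_apply mem_Collect_eq)
qed

section \<open>Flag connectivity as reachability\<close>

definition flag_step :: "'a ranked_poset \<Rightarrow> 'a set \<Rightarrow> 'a set \<Rightarrow> 'a set \<Rightarrow> bool" where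
  "flag_step K B \<Phi> \<Psi> \<longleftrightarrow>
    \<Phi> \<in> flags K \<and> \<Psi> \<in> flags K \<and> B \<subseteq> \<Phi> \<and> B \<subseteq> \<Psi> \<and> adjacent_flags \<Phi> \<Psi>"

lemma flag_step_antimono: "flag_step K B \<Phi> \<Psi> \<Longrightarrow> A \<subseteq> B \<Longrightarrow> flag_step K A \<Phi> \<Psi>"
  by (auto simp: flag_step_def)

lemma flag_steps_antimono:
  "(flag_step K B)\<^sup>*\<^sup>* \<Phi> \<Psi> \<Longrightarrow> A \<subseteq> B \<Longrightarrow> (flag_step K A)\<^sup>*\<^sup>* \<Phi> \<Psi>"
  by (erule mono_rtranclp[rule_format, rotated]) (rule flag_step_antimono)

text \<open>A path of length \<open>l\<close> is an instance of the \<open>l\<close>-th power of the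
  step relation. Flag membership and the faces to be kept are built into each step, so that paths
  can be concatenated and treated by induction on \<open>rtranclp\<close>.\<close>

lemma strongly_flag_connected_iff_steps:
  "strongly_flag_connected K \<longleftrightarrow>
    (\<forall>\<Phi>\<in>flags K. \<forall>\<Psi>\<in>flags K. (flag_step K (\<Phi> \<inter> \<Psi>))\<^sup>*\<^sup>* \<Phi> \<Psi>)"
proof -
  have "(\<exists>(c :: nat \<Rightarrow> 'a set) l. c 0 = \<Phi> \<and> c l = \<Psi> \<and>
       (\<forall>t\<le>l. c t \<in> flags K \<and> \<Phi> \<inter> \<Psi> \<subseteq> c t) \<and>
       (\<forall>t<l. adjacent_flags (c t) (c (Suc t)))) \<longleftrightarrow> (flag_step K (\<Phi> \<inter> \<Psi>))\<^sup>*\<^sup>* \<Phi> \<Psi>"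
    (is "?L \<longleftrightarrow> ?R") if \<Phi>\<Psi>: "\<Phi> \<in> flags K" "\<Psi> \<in> flags K" for \<Phi> \<Psi>
  proof
    assume ?L
    then obtain c l where c: "c 0 = \<Phi>" "c l = \<Psi>"
      "\<And>t. t \<le> l \<Longrightarrow> c t \<in> flags K \<and> \<Phi> \<inter> \<Psi> \<subseteq> c t"
      "\<And>t. t < l \<Longrightarrow> adjacent_flags (c t) (c (Suc t))" by blast
    have "\<forall>t<l. flag_step K (\<Phi> \<inter> \<Psi>) (c t) (c (Suc t))"
      unfolding flag_step_def using c by (meson Suc_leI less_imp_le)
    then have "(flag_step K (\<Phi> \<inter> \<Psi>) ^^ l) \<Phi> \<Psi>"
      using c(1,2) unfolding relpowp_fun_conv by blast
    then show ?R by (rule relpowp_imp_rtranclp)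
  next
    assume ?R
    then obtain l where "(flag_step K (\<Phi> \<inter> \<Psi>) ^^ l) \<Phi> \<Psi>"
      using rtranclp_imp_relpowp by fast
    then obtain c where c: "c 0 = \<Phi>" "c l = \<Psi>"
      "\<And>t. t < l \<Longrightarrow> flag_step K (\<Phi> \<inter> \<Psi>) (c t) (c (Suc t))"
      unfolding relpowp_fun_conv by blast
    \<comment> \<open>No step leaves the last flag, so for \<open>t = l\<close> the claim comes from
      the assumption on \<Psi>.\<close>
    have "c t \<in> flags K \<and> \<Phi> \<inter> \<Psi> \<subseteq> c t" if "t \<le> l" for t
      using c \<Phi>\<Psi> that by (cases "t = l") (auto simp: flag_step_def)
    moreover have "\<forall>t<l. adjacent_flags (c t) (c (Suc t))"
      using c(3) by (simp add: flag_step_def)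
    ultimately show ?L using c(1,2) by blast
  qed
  then show ?thesis unfolding strongly_flag_connected_def by simp
qed

section \<open>Consequences of the polytope axioms\<close>

context
  fixes m :: int and K :: "'a ranked_poset"
  assumes poly: "abstract_polytope m K"
begin

lemma polytope_refl: "F \<in> faces K \<Longrightarrow> face_le K F F"
  and polytope_antisym:
    "F \<in> faces K \<Longrightarrow> G \<in> faces K \<Longrightarrow> face_le K F G \<Longrightarrow> face_le K G F \<Longrightarrow> F = G"
  and polytope_trans: "F \<in> faces K \<Longrightarrow> G \<in> faces K \<Longrightarrow> H \<in> faces K \<Longrightarrow>
    face_le K F G \<Longrightarrow> face_le K G H \<Longrightarrow> face_le K F H"
  and polytope_rank_less: "F \<in> faces K \<Longrightarrow> G \<in> faces K \<Longrightarrow> face_le K F G \<Longrightarrow> F \<noteq> G \<Longrightarrow>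
    face_rank K F < face_rank K G"
  and polytope_rank_image: "face_rank K ` faces K = {-1..m}"
  and polytope_flag_card: "\<Phi> \<in> flags K \<Longrightarrow> int (card \<Phi>) = m + 2"
  and polytope_connected: "strongly_flag_connected K"
  using poly unfolding abstract_polytope_def reflp_on_def antisymp_on_def transp_on_def
    monotone_on_def face_less_def
  by (blast+)

lemma polytope_diamond:
  assumes "F \<in> faces K" "G \<in> faces K" "face_le K F G" "F \<noteq> G" "face_rank K G = face_rank K F + 2"
  shows "card {H \<in> faces K. face_less K F H \<and> face_less K H G} = 2"
  using poly assms unfolding abstract_polytope_def diamond_condition_def face_less_def by blast

lemma polytope_reflp: "reflp_on (faces K) (face_le K)"
  using poly by (simp add: abstract_polytope_def)

lemmas polytope_flags_iff = flags_iff[OF polytope_reflp]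

lemma flag_subset_faces: "\<Phi> \<in> flags K \<Longrightarrow> \<Phi> \<subseteq> faces K"
  and flag_face_chain: "\<Phi> \<in> flags K \<Longrightarrow> face_chain K \<Phi>"
  by (simp_all add: polytope_flags_iff face_chain_def)

lemma polytope_least:
  obtains F where "F \<in> faces K" "face_rank K F = -1" "\<And>G. G \<in> faces K \<Longrightarrow> face_le K F G"
proof -
  obtain F where F: "F \<in> faces K" "\<And>G. G \<in> faces K \<Longrightarrow> face_le K F G"
    using poly unfolding abstract_polytope_def by blast
  have "face_rank K F \<in> {-1..m}" using polytope_rank_image F(1) by blast
  \<comment> \<open>The rank of \<open>F\<close> shows that the interval of ranks is nonempty; hence
    -1 is attained by some face.\<close>
  then have "-1 \<in> {-1..m}" "-1 \<le> face_rank K F" by auto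
  then obtain G where G: "G \<in> faces K" "face_rank K G = -1"
    using polytope_rank_image by (metis imageE)
  have "F = G"
    using polytope_rank_less[OF F(1) G(1) F(2)[OF G(1)]] G(2) \<open>-1 \<le> face_rank K F\<close> by linarith
  then show ?thesis using that F G by blast
qed

lemma polytope_greatest:
  obtains F where "F \<in> faces K" "face_rank K F = m" "\<And>G. G \<in> faces K \<Longrightarrow> face_le K G F"
proof -
  obtain F where F: "F \<in> faces K" "\<And>G. G \<in> faces K \<Longrightarrow> face_le K G F"
    using poly unfolding abstract_polytope_def by blast
  have "face_rank K F \<in> {-1..m}" using polytope_rank_image F(1) by blast
  then have "m \<in> {-1..m}" "face_rank K F \<le> m" by auto
  then obtain G where G: "G \<in> faces K" "face_rank K G = m"
    using polytope_rank_image by (metis imageE)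
  have "F = G"
    using polytope_rank_less[OF G(1) F(1) F(2)[OF G(1)]] G(2) \<open>face_rank K F \<le> m\<close> by fastforce
  then show ?thesis using that F G by blast
qed

lemma comparable_rank_eq:
  assumes "F \<in> faces K" "G \<in> faces K" "face_le K F G \<or> face_le K G F"
    "face_rank K F = face_rank K G"
  shows "F = G"
  using polytope_rank_less[of F G] polytope_rank_less[of G F] assms by (metis less_irrefl)

lemma comparable_rank_le:
  assumes "F \<in> faces K" "G \<in> faces K" "face_le K F G \<or> face_le K G F"
    "face_rank K F \<le> face_rank K G"
  shows "face_le K F G"
  using polytope_rank_less[of G F] assms polytope_refl by (metis not_less)

lemma face_chain_inj_rank: "face_chain K C \<Longrightarrow> inj_on (face_rank K) C"
  by (rule inj_onI) (meson face_chainD face_chain_def comparable_rank_eq subsetD)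

text \<open>The rank is injective on a chain, and a flag has as many faces as there are ranks, so
  every rank occurs.\<close>

lemma flag_rank_image:
  assumes "\<Phi> \<in> flags K"
  shows "face_rank K ` \<Phi> = {-1..m}"
proof (rule card_subset_eq)
  show "face_rank K ` \<Phi> \<subseteq> {-1..m}"
    using flag_subset_faces[OF assms] polytope_rank_image by blast
  have "card (face_rank K ` \<Phi>) = card \<Phi>"
    by (rule card_image[OF face_chain_inj_rank[OF flag_face_chain[OF assms]]])
  then show "card (face_rank K ` \<Phi>) = card {-1..m}"
    using polytope_flag_card[OF assms] by simp
qed simp

lemma flag_obtain_rank:
  assumes "\<Phi> \<in> flags K" "-1 \<le> i" "i \<le> m"
  obtains F where "F \<in> \<Phi>" "face_rank K F = i"
  using flag_rank_image[OF assms(1)] assms(2,3) by (metis atLeastAtMost_iff imageE)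

text \<open>A face comparable with the whole chain shares its rank with some member, and comparable
  faces of equal rank coincide; so nothing can be added.\<close>

lemma face_chain_rank_image_flag:
  assumes C: "face_chain K C" and ranks: "{-1..m} \<subseteq> face_rank K ` C"
  shows "C \<in> flags K"
proof -
  have "H \<in> C" if H: "H \<in> faces K" "\<forall>F\<in>C. face_le K F H \<or> face_le K H F" for H
  proof -
    have "face_rank K H \<in> face_rank K ` C"
      using H(1) polytope_rank_image ranks by blast
    then obtain F where "F \<in> C" "face_rank K F = face_rank K H" by auto
    then show ?thesis
      using comparable_rank_eq[of F H] C H by (auto simp: face_chain_def)
  qed
  then show ?thesis using C by (auto simp: polytope_flags_iff)
qed

text \<open>Between the faces of ranks \<open>i - 1\<close> and \<open>i + 1\<close> of \<Phi> the
  diamond condition leaves exactly two faces, the \<open>i\<close>-face \<open>H\<close> of \<Phi>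
  and one other, \<open>H'\<close>. Exchanging them gives the flag \<Omega>, the only candidate. The
  second claim is proved along with the first because it reads the two set differences off
  \<Omega>.\<close>

lemma ex_adjacent_flag:
  assumes \<Phi>: "\<Phi> \<in> flags K" and i: "0 \<le> i" "i \<le> m - 1"
  shows "\<exists>!\<Psi>. \<Psi> \<in> flags K \<and> \<Psi> \<noteq> \<Phi> \<and>
      {F \<in> \<Psi>. face_rank K F \<noteq> i} = {F \<in> \<Phi>. face_rank K F \<noteq> i}" (is "\<exists>!\<Psi>. ?Q \<Psi>")
    and "\<Psi> \<in> flags K \<Longrightarrow> \<Psi> \<noteq> \<Phi> \<Longrightarrow>
      {F \<in> \<Psi>. face_rank K F \<noteq> i} = {F \<in> \<Phi>. face_rank K F \<noteq> i} \<Longrightarrow> adjacent_flags \<Phi> \<Psi>"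
proof -
  have sub: "\<Phi> \<subseteq> faces K" and ch: "face_chain K \<Phi>"
    using \<Phi> by (rule flag_subset_faces, rule flag_face_chain)
  obtain F where F: "F \<in> \<Phi>" "face_rank K F = i - 1"
    using flag_obtain_rank[OF \<Phi>, of "i - 1"] i by auto
  obtain G where G: "G \<in> \<Phi>" "face_rank K G = i + 1"
    using flag_obtain_rank[OF \<Phi>, of "i + 1"] i by auto
  obtain H where H: "H \<in> \<Phi>" "face_rank K H = i"
    using flag_obtain_rank[OF \<Phi>, of i] i by auto
  let ?B = "{H \<in> faces K. face_less K F H \<and> face_less K H G}"
  have le: "face_le K X Y" if "face_chain K C" "X \<in> C" "Y \<in> C" "face_rank K X \<le> face_rank K Y" for X Y C
    using comparable_rank_le[of X Y] that face_chainD[OF that(1), of X Y] by (auto simp: face_chain_def)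
  have "card ?B = 2"
    using polytope_diamond[of F G] F G sub le[OF ch] by force
  \<comment> \<open>Every flag through \<open>F\<close> and \<open>G\<close> has its
    \<open>i\<close>-face in the diamond; this serves for \<Phi> itself and for any candidate
    \<Psi>.\<close>
  have between: "X \<in> ?B" if "\<Psi> \<in> flags K" "F \<in> \<Psi>" "G \<in> \<Psi>" "X \<in> \<Psi>" "face_rank K X = i" for X \<Psi>
    using that F(2) G(2) le[OF flag_face_chain[OF that(1)]] flag_subset_faces[OF that(1)]
    by (fastforce simp: face_less_def)
  have HB: "H \<in> ?B" using between[OF \<Phi>] F G H by blast
  obtain H' where H': "?B = {H, H'}" "H' \<noteq> H"
    using \<open>card ?B = 2\<close> HB unfolding card_2_iff by (metis (no_types, lifting) insert_commute insert_iff singletonD)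
  then have H'B: "H' \<in> faces K" "face_le K F H'" "face_le K H' G" "F \<noteq> H'" "H' \<noteq> G"
    by (auto simp: face_less_def)
  have rH': "face_rank K H' = i"
    using polytope_rank_less[of F H'] polytope_rank_less[of H' G] H'B F G sub by force
  have uniqH: "X = H" if "X \<in> \<Phi>" "face_rank K X = i" for X
    using inj_onD[OF face_chain_inj_rank[OF ch]] that H by metis
  have "H' \<notin> \<Phi>" using uniqH rH' H'(2) by blast
  define \<Omega> where "\<Omega> = insert H' (\<Phi> - {H})"
  \<comment> \<open>A face of \<Phi> other than \<open>H\<close> lies below \<open>F\<close> or
    above \<open>G\<close>, so its comparability with \<open>H'\<close> follows by
    transitivity.\<close>
  have cmp: "face_le K X H' \<or> face_le K H' X" if X: "X \<in> \<Phi>" "X \<noteq> H" for X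
  proof -
    have "face_rank K X \<noteq> i" using uniqH X by blast
    then consider "face_rank K X \<le> i - 1" | "face_rank K X \<ge> i + 1" by linarith
    then show ?thesis
    proof cases
      case 1
      then have "face_le K X F" using le[OF ch] X F by simp
      then show ?thesis using polytope_trans[of X F H'] X F H'B sub by blast
    next
      case 2
      then have "face_le K G X" using le[OF ch] X G by simp
      then show ?thesis using polytope_trans[of H' G X] X G H'B sub by blast
    qed
  qed
  have "face_chain K \<Omega>"
    using ch cmp H'B(1) polytope_refl unfolding face_chain_def \<Omega>_def by blast
  moreover have "face_rank K ` \<Omega> = face_rank K ` \<Phi>"
    unfolding \<Omega>_def using H rH' by (auto simp: image_iff)
  ultimately have \<Omega>fl: "\<Omega> \<in> flags K"
    using face_chain_rank_image_flag flag_rank_image[OF \<Phi>] by simp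
  have "{F \<in> \<Omega>. face_rank K F \<noteq> i} = {F \<in> \<Phi>. face_rank K F \<noteq> i}"
    using H rH' by (auto simp: \<Omega>_def)
  then have Q\<Omega>: "?Q \<Omega>"
    using \<Omega>fl \<open>H' \<notin> \<Phi>\<close> by (auto simp: \<Omega>_def)
  have eq: "\<Psi> = \<Omega>" if Q: "?Q \<Psi>" for \<Psi>
  proof -
    have Q1: "\<Psi> \<in> flags K" "\<Psi> \<noteq> \<Phi>" and Q2: "\<And>X. face_rank K X \<noteq> i \<Longrightarrow> X \<in> \<Psi> \<longleftrightarrow> X \<in> \<Phi>"
      using Q by blast+
    obtain X where X: "X \<in> \<Psi>" "face_rank K X = i"
      using flag_obtain_rank[OF Q1(1), of i] i by auto
    have uniqX: "Y = X" if "Y \<in> \<Psi>" "face_rank K Y = i" for Y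
      using inj_onD[OF face_chain_inj_rank[OF flag_face_chain[OF Q1(1)]]] that X by metis
    have "X \<in> ?B"
      by (rule between[OF Q1(1)]) (use Q2 F G X in auto)
    \<comment> \<open>With the same \<open>i\<close>-face as well, \<Psi> would coincide with
      \<Phi>.\<close>
    moreover have "X \<noteq> H"
    proof
      assume "X = H"
      then have "Y \<in> \<Psi> \<longleftrightarrow> Y \<in> \<Phi>" for Y
        using Q2[of Y] uniqX[of Y] uniqH[of Y] X(1) H(1) by (cases "face_rank K Y = i") blast+
      then show False using Q1(2) by blast
    qed
    ultimately have "X = H'" using H'(1) by blast
    then have "Y \<in> \<Psi> \<longleftrightarrow> Y \<in> \<Omega>" for Y
      using Q2[of Y] uniqX[of Y] uniqH[of Y] X(1) H rH' unfolding \<Omega>_def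
      by (cases "face_rank K Y = i") blast+
    then show ?thesis by blast
  qed
  show "\<exists>!\<Psi>. ?Q \<Psi>" by (rule ex1I[of ?Q, OF Q\<Omega> eq])
  assume "\<Psi> \<in> flags K" "\<Psi> \<noteq> \<Phi>"
    "{F \<in> \<Psi>. face_rank K F \<noteq> i} = {F \<in> \<Phi>. face_rank K F \<noteq> i}"
  then have "\<Psi> = \<Omega>" by (intro eq conjI)
  then have "\<Phi> - \<Psi> = {H}" "\<Psi> - \<Phi> = {H'}"
    using H(1) \<open>H' \<notin> \<Phi>\<close> H'(2) by (auto simp: \<Omega>_def)
  then show "adjacent_flags \<Phi> \<Psi>" by (simp add: adjacent_flags_def)
qed

lemma adj_flag_props:
  assumes "\<Phi> \<in> flags K" "0 \<le> i" "i \<le> m - 1"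
  shows "adj_flag K i \<Phi> \<in> flags K" "adj_flag K i \<Phi> \<noteq> \<Phi>"
    "{F \<in> adj_flag K i \<Phi>. face_rank K F \<noteq> i} = {F \<in> \<Phi>. face_rank K F \<noteq> i}"
  using theI'[OF ex_adjacent_flag(1)[OF assms]] unfolding adj_flag_def by blast+

lemma adj_flag_eqI:
  assumes "\<Phi> \<in> flags K" "0 \<le> i" "i \<le> m - 1" "\<Psi> \<in> flags K" "\<Psi> \<noteq> \<Phi>"
    "{F \<in> \<Psi>. face_rank K F \<noteq> i} = {F \<in> \<Phi>. face_rank K F \<noteq> i}"
  shows "adj_flag K i \<Phi> = \<Psi>"
  unfolding adj_flag_def
  by (rule the1_equality[OF ex_adjacent_flag(1)[OF assms(1-3)]]) (use assms in blast)

lemma adjacent_adj_flag: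
  assumes "\<Phi> \<in> flags K" "0 \<le> i" "i \<le> m - 1"
  shows "adjacent_flags \<Phi> (adj_flag K i \<Phi>)"
  by (rule ex_adjacent_flag(2)[OF assms adj_flag_props[OF assms]])

text \<open>Since \<open>adj_flag K i \<Phi>\<close> is adjacent to \<Phi>, chirality keeps it out
  of the orbit of \<Phi>. The chiral case thus becomes the case of an empty index set.\<close>

lemma chiral_in_class_two:
  assumes "chiral_polytope m K"
  shows "in_class_two m {} K"
proof -
  have "adj_flag K i \<Phi> \<notin> flag_orbit K \<Phi>" if "\<Phi> \<in> flags K" "i \<in> {0..m - 1}" for \<Phi> i
    using assms adj_flag_props(1)[of \<Phi> i] adjacent_adj_flag[of \<Phi> i] that
    by (auto simp: chiral_polytope_def)
  then show ?thesis using assms by (simp add: in_class_two_def chiral_polytope_def)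
qed

text \<open>For negative \<open>m\<close> all faces of a flag have rank -1, so there is at most one
  flag and one orbit. The bound guarantees that flags of \<open>K\<close> have a vertex, whose
  exchange accounts for the index 0 in the class of the power polytope.\<close>

lemma two_orbit_rank_nonneg:
  assumes "orbit_polytope m 2 K"
  shows "0 \<le> m"
proof (rule ccontr)
  assume neg: "\<not> 0 \<le> m"
  obtain F where F: "F \<in> faces K" "\<And>G. G \<in> faces K \<Longrightarrow> face_le K F G"
    using polytope_least by blast
  have "flags K \<subseteq> {{F}}"
  proof
    fix \<Phi> assume \<Phi>: "\<Phi> \<in> flags K"
    have "F \<in> \<Phi>" using \<Phi> F flag_subset_faces[OF \<Phi>] unfolding polytope_flags_iff by blast
    moreover have "\<Phi> = {X}" if "X \<in> \<Phi>" for X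
    proof -
      have "face_rank K Y = -1" if "Y \<in> \<Phi>" for Y
      proof -
        have "face_rank K Y \<in> {-1..m}" using flag_rank_image[OF \<Phi>] that by blast
        then show ?thesis using neg by simp
      qed
      then show ?thesis
        using inj_onD[OF face_chain_inj_rank[OF flag_face_chain[OF \<Phi>]]] that by fastforce
    qed
    ultimately show "\<Phi> \<in> {{F}}" by blast
  qed
  then have "flag_orbits K \<subseteq> {flag_orbit K {F}}" by (auto simp: flag_orbits_def)
  then have "card (flag_orbits K) \<le> 1" 
    using card_mono[of "{flag_orbit K {F}}" "flag_orbits K"] by simp
  then show False using assms by (simp add: orbit_polytope_def)
qed

end

section \<open>Cells of the power polytope\<close>

lemma image_subset_cancel:
  assumes "inj_on f C" "A \<subseteq> C" "B \<subseteq> C"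
  shows "f ` A \<subseteq> f ` B \<longleftrightarrow> A \<subseteq> B"
  using assms unfolding inj_on_def by blast

section \<open>Points of the cube\<close>

lemma finite_cube: "finite (cube v)"
  by (simp add: cube_def finite_PiE)

lemma cube_value: "\<epsilon> \<in> cube v \<Longrightarrow> i \<in> {1..v} \<Longrightarrow> \<epsilon> i = 0 \<or> \<epsilon> i = 1"
  by (auto simp: cube_def PiE_def Pi_def)

lemma cube_eqI:
  "\<epsilon> \<in> cube v \<Longrightarrow> \<eta> \<in> cube v \<Longrightarrow> (\<And>i. i \<in> {1..v} \<Longrightarrow> \<epsilon> i = \<eta> i) \<Longrightarrow> \<epsilon> = \<eta>"
  unfolding cube_def by (rule PiE_ext)

lemma cube_nonempty: "(\<lambda>i\<in>{1..v}. 0) \<in> cube v"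
  by (auto simp: cube_def)

definition flip :: "nat \<Rightarrow> (nat \<Rightarrow> nat) \<Rightarrow> nat \<Rightarrow> nat" where
  "flip i \<epsilon> = \<epsilon>(i := 1 - \<epsilon> i)"

lemma flip_in_cube:
  assumes "\<epsilon> \<in> cube v" "i \<in> {1..v}"
  shows "flip i \<epsilon> \<in> cube v"
  using assms cube_value[OF assms] by (auto simp: cube_def PiE_def Pi_def extensional_def flip_def)

text \<open>With truncated subtraction \<open>1 - k\<close> differs from every natural number
  \<open>k\<close>, not only from 0 and 1.\<close>

lemma flip_neq: "flip i \<epsilon> i \<noteq> \<epsilon> i"
  and flip_other: "j \<noteq> i \<Longrightarrow> flip i \<epsilon> j = \<epsilon> j"
  by (cases "\<epsilon> i"; simp add: flip_def)+

section \<open>Supports and cells\<close>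

locale describable_polytope =
  fixes m :: int and K :: "'a ranked_poset" and v :: nat and lab :: "'a \<Rightarrow> nat"
  assumes poly: "abstract_polytope m K"
    and fin: "finite (faces K)"
    and desc: "vertex_describable K"
    and lab: "bij_betw lab (vertices K) {1..v}"
begin

abbreviation P :: "(nat \<Rightarrow> nat) set ranked_poset" where
  "P \<equiv> two_power v lab K"

definition support :: "'a \<Rightarrow> nat set" where
  "support F = lab ` vertex_set K F"

definition cell :: "'a \<Rightarrow> (nat \<Rightarrow> nat) \<Rightarrow> (nat \<Rightarrow> nat) set" where
  "cell F \<epsilon> = subcube v (support F) \<epsilon>"

text \<open>The empty face fills rank -1, and the least face of \<open>K\<close> contributes the
  vertex \<open>{\<epsilon>}\<close>; hence all ranks are shifted by one.\<close>

definition flag_at :: "(nat \<Rightarrow> nat) \<Rightarrow> 'a set \<Rightarrow> (nat \<Rightarrow> nat) set set" where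
  "flag_at \<epsilon> \<Phi> = insert {} ((\<lambda>F. cell F \<epsilon>) ` \<Phi>)"

lemma lab_inj: "inj_on lab (vertices K)" and lab_image: "lab ` vertices K = {1..v}"
  using lab by (auto simp: bij_betw_def)

lemma support_subset: "support F \<subseteq> {1..v}"
  using lab_image by (auto simp: support_def vertex_set_def)

text \<open>This is the point where vertex-describability enters. As the labelling is injective on
  vertices, inclusion of supports is inclusion of vertex sets.\<close>

lemma face_le_iff_support:
  assumes "F \<in> faces K" "G \<in> faces K"
  shows "face_le K F G \<longleftrightarrow> support F \<subseteq> support G"
proof -
  have "support F \<subseteq> support G \<longleftrightarrow> vertex_set K F \<subseteq> vertex_set K G"
    unfolding support_def by (rule image_subset_cancel[OF lab_inj]) (auto simp: vertex_set_def)
  then show ?thesis using desc assms by (auto simp: vertex_describable_def)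
qed

lemma lab_in_support_iff: "x \<in> vertices K \<Longrightarrow> lab x \<in> support F \<longleftrightarrow> face_le K x F"
  using inj_on_image_mem_iff[OF lab_inj, of x "vertex_set K F"]
  by (auto simp: support_def vertex_set_def)

lemma support_least:
  assumes "F \<in> faces K" "face_rank K F = -1"
  shows "support F = {}"
proof -
  have "\<not> face_le K x F" if "x \<in> vertices K" for x
    using polytope_rank_less[OF poly, of x F] that assms by (fastforce simp: vertices_def)
  then show ?thesis by (auto simp: support_def vertex_set_def)
qed

lemma support_vertex:
  assumes "x \<in> vertices K"
  shows "support x = {lab x}"
proof -
  have "y = x" if "y \<in> vertices K" "face_le K y x" for y
    using comparable_rank_eq[OF poly, of y x] that assms by (auto simp: vertices_def)
  then have "vertex_set K x = {x}"
    using assms polytope_refl[OF poly, of x] by (auto simp: vertex_set_def vertices_def)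
  then show ?thesis by (simp add: support_def)
qed

lemma support_greatest:
  assumes "\<And>G. G \<in> faces K \<Longrightarrow> face_le K G F"
  shows "support F = {1..v}"
proof -
  have "vertex_set K F = vertices K"
    using assms by (auto simp: vertex_set_def vertices_def)
  then show ?thesis using lab_image by (simp add: support_def)
qed

lemma mem_cell_iff:
  "\<eta> \<in> cell F \<epsilon> \<longleftrightarrow> \<eta> \<in> cube v \<and> (\<forall>i\<in>{1..v}. \<eta> i \<noteq> \<epsilon> i \<longrightarrow> i \<in> support F)"
  by (auto simp: cell_def subcube_def)

lemma cell_subset_cube: "cell F \<epsilon> \<subseteq> cube v"
  by (auto simp: mem_cell_iff)

lemma center_in_cell: "\<epsilon> \<in> cube v \<Longrightarrow> \<epsilon> \<in> cell F \<epsilon>"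
  by (simp add: mem_cell_iff)

lemma cell_nonempty: "\<epsilon> \<in> cube v \<Longrightarrow> cell F \<epsilon> \<noteq> {}"
  using center_in_cell by blast

text \<open>Outside \<open>support F\<close> the two points agree, so they prescribe the same
  coordinates: any point of a cell can serve as its centre.\<close>

lemma cell_recenter:
  assumes "\<eta> \<in> cell F \<epsilon>"
  shows "cell F \<eta> = cell F \<epsilon>"
proof -
  have "\<eta> i = \<epsilon> i" if "i \<in> {1..v}" "i \<notin> support F" for i using assms that by (auto simp: mem_cell_iff)
  then show ?thesis by (fastforce simp: set_eq_iff mem_cell_iff)
qed

text \<open>A flip changes exactly one coordinate and therefore tests a single element of the
  support. In this way the support can be read off the cell.\<close>

lemma flip_in_cell_iff:
  assumes "\<epsilon> \<in> cube v" "i \<in> {1..v}"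
  shows "flip i \<epsilon> \<in> cell F \<epsilon> \<longleftrightarrow> i \<in> support F"
proof
  assume "flip i \<epsilon> \<in> cell F \<epsilon>"
  then show "i \<in> support F" using flip_neq[of i \<epsilon>] assms(2) unfolding mem_cell_iff by blast
next
  assume "i \<in> support F"
  moreover have "j = i" if "flip i \<epsilon> j \<noteq> \<epsilon> j" for j
    using that by (auto simp: flip_def split: if_splits)
  ultimately show "flip i \<epsilon> \<in> cell F \<epsilon>"
    using flip_in_cube[OF assms] unfolding mem_cell_iff by blast
qed

text \<open>Applied to the flips of \<epsilon>, inclusion of cells gives inclusion of supports; the
  converse direction only relaxes constraints.\<close>

lemma cell_subset_iff:
  assumes "F \<in> faces K" "G \<in> faces K" "\<epsilon> \<in> cube v"
  shows "cell F \<epsilon> \<subseteq> cell G \<epsilon> \<longleftrightarrow> face_le K F G"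
proof
  assume sub: "cell F \<epsilon> \<subseteq> cell G \<epsilon>"
  have "support F \<subseteq> support G"
  proof
    fix i assume "i \<in> support F"
    then have "i \<in> {1..v}" using support_subset by blast
    then show "i \<in> support G" using flip_in_cell_iff[OF assms(3)] sub \<open>i \<in> support F\<close> by blast
  qed
  then show "face_le K F G" using face_le_iff_support assms by blast
next
  assume "face_le K F G"
  then have "support F \<subseteq> support G" using face_le_iff_support assms by blast
  then show "cell F \<epsilon> \<subseteq> cell G \<epsilon>" unfolding subset_iff mem_cell_iff by blast
qed

lemma cell_eqD:
  assumes "F \<in> faces K" "G \<in> faces K" "\<epsilon> \<in> cube v" "cell F \<epsilon> = cell G \<epsilon>"
  shows "F = G"
  using assms cell_subset_iff[of F G \<epsilon>] cell_subset_iff[of G F \<epsilon>] polytope_antisym[OF poly] by blast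

lemma cell_inj_on: "\<epsilon> \<in> cube v \<Longrightarrow> inj_on (\<lambda>F. cell F \<epsilon>) (faces K)"
  by (rule inj_onI) (rule cell_eqD)

lemma cell_least:
  assumes "F \<in> faces K" "face_rank K F = -1" "\<epsilon> \<in> cube v"
  shows "cell F \<epsilon> = {\<epsilon>}"
  using support_least[OF assms(1,2)] assms(3) by (auto simp: mem_cell_iff intro: cube_eqI)

section \<open>Faces and ranks of the power polytope\<close>

lemma faces_P: "faces P = insert {} {cell F \<epsilon> | F \<epsilon>. F \<in> faces K \<and> \<epsilon> \<in> cube v}"
  by (simp add: two_power_def cell_def support_def)

lemma face_le_P: "face_le P = (\<subseteq>)"
  by (simp add: two_power_def)

lemma face_less_P: "face_less P X Y \<longleftrightarrow> X \<subset> Y"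
  by (auto simp: face_less_def face_le_P)

lemma cell_in_P: "F \<in> faces K \<Longrightarrow> \<epsilon> \<in> cube v \<Longrightarrow> cell F \<epsilon> \<in> faces P"
  by (auto simp: faces_P)

lemma empty_in_P: "{} \<in> faces P"
  by (simp add: faces_P)

lemma P_subset_cube: "X \<in> faces P \<Longrightarrow> X \<subseteq> cube v"
  using cell_subset_cube by (auto simp: faces_P)

text \<open>Recentering lets faces with a common point be written with the same centre, where they
  are compared as faces of \<open>K\<close>.\<close>

lemma face_P_at:
  assumes "X \<in> faces P" "\<epsilon> \<in> X"
  obtains F where "F \<in> faces K" "X = cell F \<epsilon>"
  using assms cell_recenter by (auto simp: faces_P)

lemma finite_faces_P: "finite (faces P)"
proof -
  have "faces P = insert {} ((\<lambda>(F, \<epsilon>). cell F \<epsilon>) ` (faces K \<times> cube v))"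
    by (auto simp: faces_P)
  then show ?thesis by (simp add: fin finite_cube)
qed

lemma rank_P_empty: "face_rank P {} = -1"
  by (simp add: two_power_def)

text \<open>A cell has many centres, so the \<open>THE\<close> in the rank needs an argument:
  another description \<open>cell G \<eta>\<close> is recentered at \<epsilon>, and there the face
  of \<open>K\<close> is unique.\<close>

lemma rank_P_cell:
  assumes "F \<in> faces K" "\<epsilon> \<in> cube v"
  shows "face_rank P (cell F \<epsilon>) = face_rank K F + 1"
proof -
  have "(THE j. \<exists>G\<in>faces K. \<exists>\<eta>\<in>cube v. cell F \<epsilon> = cell G \<eta> \<and> j = face_rank K G + 1)
    = face_rank K F + 1"
  proof (rule the_equality)
    fix j assume "\<exists>G\<in>faces K. \<exists>\<eta>\<in>cube v. cell F \<epsilon> = cell G \<eta> \<and> j = face_rank K G + 1"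
    then obtain G \<eta> where G: "G \<in> faces K" "cell F \<epsilon> = cell G \<eta>" "j = face_rank K G + 1" by blast
    have "cell G \<eta> = cell G \<epsilon>"
      using cell_recenter G(2) center_in_cell[OF assms(2), of F] by blast
    then have "F = G" using cell_eqD assms G by metis
    then show "j = face_rank K F + 1" using G by simp
  qed (use assms in blast)
  then show ?thesis
    using cell_nonempty[OF assms(2), of F] by (simp add: two_power_def cell_def support_def)
qed

lemma rank_K_ge: "F \<in> faces K \<Longrightarrow> -1 \<le> face_rank K F"
  using polytope_rank_image[OF poly] by fastforce

lemma P_reflp: "reflp_on (faces P) (face_le P)"
  by (simp add: face_le_P reflp_on_def)

lemmas P_flags_iff = flags_iff[OF P_reflp]

section \<open>Flags of the power polytope\<close>

lemma least_in_flag: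
  assumes "\<Phi> \<in> flags K"
  obtains L where "L \<in> \<Phi>" "L \<in> faces K" "face_rank K L = -1"
proof -
  obtain L where L: "L \<in> faces K" "face_rank K L = -1" "\<And>G. G \<in> faces K \<Longrightarrow> face_le K L G"
    using polytope_least[OF poly] by blast
  then have "L \<in> \<Phi>"
    using assms flag_subset_faces[OF poly assms] unfolding polytope_flags_iff[OF poly] by blast
  then show ?thesis using that L by blast
qed

lemma cell_in_flag_at: "F \<in> \<Phi> \<Longrightarrow> cell F \<epsilon> \<in> flag_at \<epsilon> \<Phi>"
  by (simp add: flag_at_def)

lemma flag_at_chain:
  assumes "face_chain K C" "\<epsilon> \<in> cube v"
  shows "face_chain P (flag_at \<epsilon> C)"
proof -
  have sub: "C \<subseteq> faces K" using assms(1) by (simp add: face_chain_def)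
  have "cell F \<epsilon> \<subseteq> cell G \<epsilon> \<or> cell G \<epsilon> \<subseteq> cell F \<epsilon>" if "F \<in> C" "G \<in> C" for F G
    using face_chainD[OF assms(1) that] cell_subset_iff[OF _ _ assms(2)] that sub by blast
  then show ?thesis
    using sub assms(2) by (auto simp: face_chain_def flag_at_def face_le_P empty_in_P cell_in_P)
qed

lemma flag_at_flag:
  assumes \<Phi>: "\<Phi> \<in> flags K" and \<epsilon>: "\<epsilon> \<in> cube v"
  shows "flag_at \<epsilon> \<Phi> \<in> flags P"
proof -
  have sub: "\<Phi> \<subseteq> faces K" by (rule flag_subset_faces[OF poly \<Phi>])
  obtain L where L: "L \<in> \<Phi>" "cell L \<epsilon> = {\<epsilon>}"
    using least_in_flag[OF \<Phi>] cell_least \<epsilon> by metis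
  have "X \<in> flag_at \<epsilon> \<Phi>"
    if X: "X \<in> faces P" "\<forall>Y\<in>flag_at \<epsilon> \<Phi>. Y \<subseteq> X \<or> X \<subseteq> Y" for X
  proof (cases "X = {}")
    case False
    have "{\<epsilon>} \<in> flag_at \<epsilon> \<Phi>" using cell_in_flag_at[OF L(1), of \<epsilon>] L(2) by simp
    \<comment> \<open>A nonempty face comparable with the vertex \<open>{\<epsilon>}\<close> must
      contain \<epsilon> and can be centred there, so the maximality of \<Phi> applies.\<close>
    then have "\<epsilon> \<in> X" using X(2) False by blast
    then obtain F where F: "F \<in> faces K" "X = cell F \<epsilon>" using face_P_at X(1) by blast
    have "face_le K G F \<or> face_le K F G" if "G \<in> \<Phi>" for G
    proof -
      have "G \<in> faces K" using that sub by blast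
      moreover have "cell G \<epsilon> \<subseteq> cell F \<epsilon> \<or> cell F \<epsilon> \<subseteq> cell G \<epsilon>"
        using X(2) cell_in_flag_at[OF that] F(2) by blast
      ultimately show ?thesis using cell_subset_iff F(1) \<epsilon> by blast
    qed
    then have "F \<in> \<Phi>" using F(1) \<Phi> unfolding polytope_flags_iff[OF poly] by blast
    then show ?thesis using F by (simp add: flag_at_def)
  qed (simp add: flag_at_def)
  then show ?thesis
    unfolding P_flags_iff face_le_P
    using flag_at_chain[OF flag_face_chain[OF poly \<Phi>] \<epsilon>] by blast
qed

text \<open>Take a minimal nonempty member \<open>M\<close>. The members are pairwise comparable, so
  any point \<epsilon> of \<open>M\<close> lies in every nonempty member, and each of these is a
  cell centred at \<epsilon>. The faces of \<open>K\<close> that occur inherit both comparability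
  and maximality.\<close>

lemma flag_P_cases:
  assumes "X \<in> flags P"
  obtains \<epsilon> \<Phi> where "\<epsilon> \<in> cube v" "\<Phi> \<in> flags K" "X = flag_at \<epsilon> \<Phi>"
proof -
  have Xch: "face_chain P X" and Xmax: "\<And>Y. Y \<in> faces P \<Longrightarrow> \<forall>Z\<in>X. Z \<subseteq> Y \<or> Y \<subseteq> Z \<Longrightarrow> Y \<in> X"
    using assms unfolding P_flags_iff face_le_P by blast+
  have Xsub: "X \<subseteq> faces P" using Xch by (simp add: face_chain_def)
  have Xtot: "Y \<subseteq> Z \<or> Z \<subseteq> Y" if "Y \<in> X" "Z \<in> X" for Y Z
    using face_chainD[OF Xch that] by (simp add: face_le_P)
  obtain T where T: "T \<in> faces K" "\<And>G. G \<in> faces K \<Longrightarrow> face_le K G T"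
    using polytope_greatest[OF poly] by blast
  have top: "cell T \<epsilon> = cube v" for \<epsilon>
    using support_greatest[OF T(2)] by (auto simp: mem_cell_iff)
  have "cube v \<in> faces P" using cell_in_P[OF T(1) cube_nonempty] top by simp
  \<comment> \<open>The whole cube is comparable with every face, so it lies in the flag and
    provides a nonempty member.\<close>
  then have "cube v \<in> X" using Xmax P_subset_cube Xsub by blast
  have "finite (X - {{}})" using finite_subset[OF Xsub finite_faces_P] by simp
  moreover have "cube v \<in> X - {{}}" using \<open>cube v \<in> X\<close> cube_nonempty by blast
  ultimately obtain M where M: "M \<in> X - {{}}" "\<And>Y. Y \<in> X - {{}} \<Longrightarrow> Y \<subseteq> M \<Longrightarrow> M = Y"
    using finite_has_minimal[of "X - {{}}"] by blast
  then obtain \<epsilon> where \<epsilon>: "\<epsilon> \<in> M" by blast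
  have \<epsilon>Y: "\<epsilon> \<in> Y" if "Y \<in> X" "Y \<noteq> {}" for Y
    using M \<epsilon> Xtot[of Y M] that by blast
  have \<epsilon>c: "\<epsilon> \<in> cube v" using \<epsilon>Y \<open>cube v \<in> X\<close> cube_nonempty by blast
  have "{} \<in> X" using Xmax empty_in_P by blast
  define \<Phi> where "\<Phi> = {F \<in> faces K. cell F \<epsilon> \<in> X}"
  have X: "X = flag_at \<epsilon> \<Phi>"
  proof
    show "X \<subseteq> flag_at \<epsilon> \<Phi>"
    proof
      fix Y assume "Y \<in> X"
      then show "Y \<in> flag_at \<epsilon> \<Phi>"
        using face_P_at[of Y \<epsilon>] \<epsilon>Y Xsub unfolding flag_at_def \<Phi>_def by blast
    qed
    show "flag_at \<epsilon> \<Phi> \<subseteq> X" using \<open>{} \<in> X\<close> by (auto simp: flag_at_def \<Phi>_def)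
  qed
  have "face_le K F G \<or> face_le K G F" if "F \<in> \<Phi>" "G \<in> \<Phi>" for F G
  proof -
    have "F \<in> faces K" "G \<in> faces K" "cell F \<epsilon> \<in> X" "cell G \<epsilon> \<in> X" using that by (simp_all add: \<Phi>_def)
    then show ?thesis
      using Xtot[of "cell F \<epsilon>" "cell G \<epsilon>"] cell_subset_iff[of F G \<epsilon>] cell_subset_iff[of G F \<epsilon>] \<epsilon>c
      by simp
  qed
  then have "face_chain K \<Phi>" by (simp add: face_chain_def \<Phi>_def)
  moreover have "H \<in> \<Phi>"
    if H: "H \<in> faces K" "\<forall>F\<in>\<Phi>. face_le K F H \<or> face_le K H F" for H
  proof -
    have "cell F \<epsilon> \<subseteq> cell H \<epsilon> \<or> cell H \<epsilon> \<subseteq> cell F \<epsilon>" if "F \<in> \<Phi>" for F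
    proof -
      have "F \<in> faces K" using that by (simp add: \<Phi>_def)
      then show ?thesis
        using H(2) that cell_subset_iff[OF _ H(1) \<epsilon>c, of F] cell_subset_iff[OF H(1) _ \<epsilon>c, of F] by simp
    qed
    then have "\<forall>Z\<in>X. Z \<subseteq> cell H \<epsilon> \<or> cell H \<epsilon> \<subseteq> Z"
      by (auto simp: X flag_at_def)
    then have "cell H \<epsilon> \<in> X" by (rule Xmax[OF cell_in_P[OF H(1) \<epsilon>c]])
    then show ?thesis using H(1) by (simp add: \<Phi>_def)
  qed
  ultimately have "\<Phi> \<in> flags K" unfolding polytope_flags_iff[OF poly] by blast
  then show ?thesis using that \<epsilon>c X by blast
qed

lemma flag_at_mem_cell:
  assumes "\<Phi> \<subseteq> faces K" "F \<in> faces K" "\<epsilon> \<in> cube v"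
  shows "cell F \<epsilon> \<in> flag_at \<epsilon> \<Phi> \<longleftrightarrow> F \<in> \<Phi>"
  using assms cell_eqD[of F _ \<epsilon>] cell_nonempty[OF assms(3), of F] by (auto simp: flag_at_def)

lemma flag_at_diff:
  assumes "\<Phi> \<subseteq> faces K" "\<Psi> \<subseteq> faces K" "\<epsilon> \<in> cube v"
  shows "flag_at \<epsilon> \<Phi> - flag_at \<epsilon> \<Psi> = (\<lambda>F. cell F \<epsilon>) ` (\<Phi> - \<Psi>)"
proof -
  have "flag_at \<epsilon> \<Phi> - flag_at \<epsilon> \<Psi> = (\<lambda>F. cell F \<epsilon>) ` \<Phi> - (\<lambda>F. cell F \<epsilon>) ` \<Psi>"
    using cell_nonempty[OF assms(3)] by (auto simp: flag_at_def)
  then show ?thesis using inj_on_image_set_diff[OF cell_inj_on[OF assms(3)], of \<Phi> \<Psi>] assms by auto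
qed

lemma flag_at_adjacent:
  assumes "\<Phi> \<subseteq> faces K" "\<Psi> \<subseteq> faces K" "\<epsilon> \<in> cube v" "adjacent_flags \<Phi> \<Psi>"
  shows "adjacent_flags (flag_at \<epsilon> \<Phi>) (flag_at \<epsilon> \<Psi>)"
proof -
  have "card ((\<lambda>F. cell F \<epsilon>) ` A) = card A" if "A \<subseteq> faces K" for A
    by (rule card_image[OF inj_on_subset[OF cell_inj_on[OF assms(3)] that]])
  then show ?thesis
    using assms by (simp add: adjacent_flags_def flag_at_diff Diff_subset subset_trans)
      (metis Diff_subset subset_trans)
qed

lemma center_in_flag_at: "\<epsilon> \<in> cube v \<Longrightarrow> X \<in> flag_at \<epsilon> \<Phi> \<Longrightarrow> X \<noteq> {} \<Longrightarrow> \<epsilon> \<in> X"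
  using center_in_cell by (auto simp: flag_at_def)

text \<open>The flag at \<epsilon> contains \<open>{\<epsilon>}\<close>, while every nonempty member
  of the flag at \<eta> contains \<eta>; this identifies the points. At a common centre the cells
  determine the faces.\<close>

lemma flag_at_inj:
  assumes "\<Phi> \<in> flags K" "\<Psi> \<in> flags K" "\<epsilon> \<in> cube v" "\<eta> \<in> cube v"
    and eq: "flag_at \<epsilon> \<Phi> = flag_at \<eta> \<Psi>"
  shows "\<epsilon> = \<eta>" "\<Phi> = \<Psi>"
proof -
  obtain L where L: "L \<in> \<Phi>" "cell L \<epsilon> = {\<epsilon>}"
    using least_in_flag[OF assms(1)] cell_least assms(3) by metis
  have "{\<epsilon>} \<in> flag_at \<eta> \<Psi>" using cell_in_flag_at[OF L(1), of \<epsilon>] L(2) eq by simp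
  then show \<epsilon>\<eta>: "\<epsilon> = \<eta>" using center_in_flag_at[OF assms(4)] by blast
  have "F \<in> \<Phi> \<longleftrightarrow> F \<in> \<Psi>" if "F \<in> faces K" for F
    using flag_at_mem_cell that eq \<epsilon>\<eta> assms(3) flag_subset_faces[OF poly] assms(1,2) by metis
  then show "\<Phi> = \<Psi>" using flag_subset_faces[OF poly] assms(1,2) by blast
qed

lemma card_flag_at:
  assumes "\<Phi> \<in> flags K" "\<epsilon> \<in> cube v"
  shows "int (card (flag_at \<epsilon> \<Phi>)) = m + 3"
proof -
  have sub: "\<Phi> \<subseteq> faces K" by (rule flag_subset_faces[OF poly assms(1)])
  have "card ((\<lambda>F. cell F \<epsilon>) ` \<Phi>) = card \<Phi>"
    by (rule card_image[OF inj_on_subset[OF cell_inj_on[OF assms(2)] sub]])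
  moreover have "{} \<notin> (\<lambda>F. cell F \<epsilon>) ` \<Phi>" using cell_nonempty[OF assms(2)] by blast
  ultimately have "card (flag_at \<epsilon> \<Phi>) = Suc (card \<Phi>)"
    using finite_subset[OF sub fin] by (simp add: flag_at_def)
  then show ?thesis using polytope_flag_card[OF poly assms(1)] by simp
qed

text \<open>Every face of \<Phi> except the least one lies above its vertex \<open>x\<close>, so
  flipping the coordinate of \<open>x\<close> stays inside its cell. Only the point itself changes,
  which makes this the exchange of vertices.\<close>

lemma flag_at_flip_diff:
  assumes \<Phi>: "\<Phi> \<in> flags K" and x: "x \<in> vertices K" "x \<in> \<Phi>" and \<epsilon>: "\<epsilon> \<in> cube v"
  shows "flag_at \<epsilon> \<Phi> - flag_at (flip (lab x) \<epsilon>) \<Phi> = {{\<epsilon>}}"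
    and "flag_at (flip (lab x) \<epsilon>) \<Phi> - flag_at \<epsilon> \<Phi> = {{flip (lab x) \<epsilon>}}"
proof -
  let ?\<eta> = "flip (lab x) \<epsilon>"
  have i: "lab x \<in> {1..v}" using x(1) lab_image by blast
  have \<eta>: "?\<eta> \<in> cube v" by (rule flip_in_cube[OF \<epsilon> i])
  have neq: "?\<eta> \<noteq> \<epsilon>" using flip_neq by metis
  obtain L where L: "L \<in> \<Phi>" "L \<in> faces K" "face_rank K L = -1" using least_in_flag[OF \<Phi>] .
  have same: "cell F ?\<eta> = cell F \<epsilon>" if F: "F \<in> \<Phi>" "F \<noteq> L" for F
  proof -
    have FK: "F \<in> faces K" using F(1) flag_subset_faces[OF poly \<Phi>] by blast
    have "face_rank K F \<noteq> -1"
      using inj_onD[OF face_chain_inj_rank[OF poly flag_face_chain[OF poly \<Phi>]], of F L] F L by auto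
    then have "face_rank K x \<le> face_rank K F"
      using rank_K_ge[OF FK] x(1) by (simp add: vertices_def)
    then have "face_le K x F"
      using comparable_rank_le[OF poly, of x F] FK x(1)
        face_chainD[OF flag_face_chain[OF poly \<Phi>] x(2) F(1)]
      by (simp add: vertices_def)
    then have "lab x \<in> support F" using lab_in_support_iff x(1) by blast
    then show ?thesis using flip_in_cell_iff[OF \<epsilon> i, of F] cell_recenter by simp
  qed
  have cellL: "cell L \<epsilon> = {\<epsilon>}" "cell L ?\<eta> = {?\<eta>}" 
    using cell_least[OF L(2,3)] \<epsilon> \<eta> by simp_all
  have split: "flag_at \<zeta> \<Phi> = insert (cell L \<zeta>) (insert {} ((\<lambda>F. cell F \<zeta>) ` (\<Phi> - {L})))" for \<zeta>
    using L(1) by (auto simp: flag_at_def)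
  have rest: "(\<lambda>F. cell F ?\<eta>) ` (\<Phi> - {L}) = (\<lambda>F. cell F \<epsilon>) ` (\<Phi> - {L})"
    using same by auto
  have "{\<epsilon>} \<notin> flag_at ?\<eta> \<Phi>" "{?\<eta>} \<notin> flag_at \<epsilon> \<Phi>"
    using center_in_flag_at[OF \<eta>, of "{\<epsilon>}"] center_in_flag_at[OF \<epsilon>, of "{?\<eta>}"] neq by auto
  then show "flag_at \<epsilon> \<Phi> - flag_at ?\<eta> \<Phi> = {{\<epsilon>}}" "flag_at ?\<eta> \<Phi> - flag_at \<epsilon> \<Phi> = {{?\<eta>}}"
    unfolding split cellL rest by blast+
qed

section \<open>The power polytope is a polytope\<close>

lemma flag_step_lift:
  assumes "(flag_step K B)\<^sup>*\<^sup>* \<Phi> \<Psi>" "\<epsilon> \<in> cube v"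
  shows "(flag_step P (flag_at \<epsilon> B))\<^sup>*\<^sup>* (flag_at \<epsilon> \<Phi>) (flag_at \<epsilon> \<Psi>)"
  using assms(1)
proof induction
  case (step \<Psi> \<Omega>)
  have "flag_step P (flag_at \<epsilon> B) (flag_at \<epsilon> \<Psi>) (flag_at \<epsilon> \<Omega>)"
    using step(2) flag_at_flag flag_at_adjacent flag_subset_faces[OF poly] assms(2)
    unfolding flag_step_def by (auto simp: flag_at_def)
  with step(3) show ?case by simp
qed simp

text \<open>The coordinates in which \<open>\<epsilon>\<close> and \<open>\<eta>\<close> differ are removed one at a time: inside the
  vertex-figure at \<open>\<epsilon>\<close> one walks to a flag whose edge points in a direction to be corrected, and then
  moves along that edge. Every common face contains the direction, so it is kept throughout.\<close>

lemma P_flag_steps: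
  assumes "\<Psi> \<in> flags K" "\<eta> \<in> cube v" "Q \<subseteq> \<Psi>"
    and "\<Phi> \<in> flags K" "\<epsilon> \<in> cube v" "Q \<subseteq> \<Phi>" "\<And>F. F \<in> Q \<Longrightarrow> \<eta> \<in> cell F \<epsilon>"
  shows "(flag_step P (flag_at \<epsilon> Q))\<^sup>*\<^sup>* (flag_at \<epsilon> \<Phi>) (flag_at \<eta> \<Psi>)"
  using assms(4-7)
proof (induction "card {i \<in> {1..v}. \<epsilon> i \<noteq> \<eta> i}" arbitrary: \<epsilon> \<Phi> rule: less_induct)
  case less
  have K_steps: "(flag_step P (flag_at \<epsilon> Q))\<^sup>*\<^sup>* (flag_at \<epsilon> \<Phi>) (flag_at \<epsilon> \<Omega>)"
    if "\<Omega> \<in> flags K" "Q \<subseteq> \<Omega>" for \<Omega>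
  proof -
    have "(flag_step K (\<Phi> \<inter> \<Omega>))\<^sup>*\<^sup>* \<Phi> \<Omega>"
      using polytope_connected[OF poly] that less.prems(1)
      by (simp add: strongly_flag_connected_iff_steps)
    then have "(flag_step K Q)\<^sup>*\<^sup>* \<Phi> \<Omega>"
      by (rule flag_steps_antimono) (use that less.prems(3) in blast)
    then show ?thesis by (rule flag_step_lift[OF _ less.prems(2)])
  qed
  show ?case
  proof (cases "\<epsilon> = \<eta>")
    case True
    then show ?thesis using K_steps[OF assms(1,3)] by simp
  next
    case False
    then obtain i where i: "i \<in> {1..v}" "\<epsilon> i \<noteq> \<eta> i" using cube_eqI less.prems(2) assms(2) by blast
    then obtain x where x: "x \<in> vertices K" "lab x = i" using lab_image by (metis imageE)
    have xQ: "i \<in> support F" if "F \<in> Q" for F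
      using less.prems(4)[OF that] i by (auto simp: mem_cell_iff)
    have "face_chain K Q"
      using flag_face_chain[OF poly less.prems(1)] less.prems(3) unfolding face_chain_def by blast
    \<comment> \<open>The vertex \<open>x\<close> of direction \<open>i\<close> lies in every face
      of \<open>Q\<close>, so some flag \<Omega> contains \<open>Q\<close> and \<open>x\<close>;
      exchanging the vertex of its lift flips coordinate \<open>i\<close>.\<close>
    then have "face_chain K (insert x Q)"
      using xQ x polytope_refl[OF poly] lab_in_support_iff[OF x(1)]
      unfolding face_chain_def vertices_def by blast
    then obtain \<Omega> where \<Omega>: "\<Omega> \<in> flags K" "insert x Q \<subseteq> \<Omega>"
      using face_chain_extends_to_flag[OF polytope_reflp[OF poly] fin] by blast
    let ?\<zeta> = "flip i \<epsilon>"
    have \<zeta>: "?\<zeta> \<in> cube v" by (rule flip_in_cube[OF less.prems(2) i(1)])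
    have cellQ: "cell F ?\<zeta> = cell F \<epsilon>" if "F \<in> Q" for F
      using flip_in_cell_iff[OF less.prems(2) i(1), of F] xQ[OF that] cell_recenter by simp
    \<comment> \<open>The cells of \<open>Q\<close> contain both points, so the faces to be kept are
      the same from either centre and the two pieces of the path fit together.\<close>
    then have Q\<zeta>: "flag_at ?\<zeta> Q = flag_at \<epsilon> Q" by (auto simp: flag_at_def)
    have "flag_at \<epsilon> Q \<subseteq> flag_at \<epsilon> \<Omega>" "flag_at ?\<zeta> Q \<subseteq> flag_at ?\<zeta> \<Omega>"
      using \<Omega>(2) by (auto simp: flag_at_def)
    moreover have "adjacent_flags (flag_at \<epsilon> \<Omega>) (flag_at ?\<zeta> \<Omega>)"
      using flag_at_flip_diff[OF \<Omega>(1) x(1) _ less.prems(2)] \<Omega>(2) x(2)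
      by (simp add: adjacent_flags_def)
    ultimately have "flag_step P (flag_at \<epsilon> Q) (flag_at \<epsilon> \<Omega>) (flag_at ?\<zeta> \<Omega>)"
      using flag_at_flag[OF \<Omega>(1)] less.prems(2) \<zeta> Q\<zeta> by (simp add: flag_step_def)
    moreover have "(flag_step P (flag_at ?\<zeta> Q))\<^sup>*\<^sup>* (flag_at ?\<zeta> \<Omega>) (flag_at \<eta> \<Psi>)"
    proof (rule less.hyps)
      \<comment> \<open>With only two values available, flipping a wrong coordinate corrects it, so
        the number of differing coordinates drops.\<close>
      have "?\<zeta> i = \<eta> i"
        using cube_value[OF less.prems(2) i(1)] cube_value[OF assms(2) i(1)] i(2)
        by (auto simp: flip_def)
      then have "{j \<in> {1..v}. ?\<zeta> j \<noteq> \<eta> j} \<subset> {j \<in> {1..v}. \<epsilon> j \<noteq> \<eta> j}"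
        using i flip_other[of _ i \<epsilon>] by (auto simp: psubset_eq) metis+
      then show "card {j \<in> {1..v}. ?\<zeta> j \<noteq> \<eta> j} < card {j \<in> {1..v}. \<epsilon> j \<noteq> \<eta> j}"
        by (intro psubset_card_mono) simp_all
    qed (use \<Omega> \<zeta> cellQ less.prems(4) in auto)
    ultimately show ?thesis
      using K_steps[OF \<Omega>(1)] \<Omega>(2) Q\<zeta>
      by (metis converse_rtranclp_into_rtranclp insert_subset rtranclp_trans)
  qed
qed

lemma P_connected: "strongly_flag_connected P"
  unfolding strongly_flag_connected_iff_steps
proof (intro ballI)
  fix X Y assume "X \<in> flags P" "Y \<in> flags P"
  then obtain \<epsilon> \<Phi> \<eta> \<Psi> where e: "\<epsilon> \<in> cube v" "\<Phi> \<in> flags K" "X = flag_at \<epsilon> \<Phi>"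
    and h: "\<eta> \<in> cube v" "\<Psi> \<in> flags K" "Y = flag_at \<eta> \<Psi>" by (meson flag_P_cases)
  \<comment> \<open>A face of \<open>K\<close> in both \<Phi> and \<Psi> gives a common cell only if
    its cells through \<epsilon> and \<eta> coincide, that is, if the cell through \<epsilon>
    contains \<eta>.\<close>
  define Q where "Q = {F \<in> \<Phi> \<inter> \<Psi>. \<eta> \<in> cell F \<epsilon>}"
  have "Z \<in> flag_at \<epsilon> Q" if Z: "Z \<in> X \<inter> Y" for Z
  proof (cases "Z = {}")
    case False
    then obtain F G where F: "F \<in> \<Phi>" "Z = cell F \<epsilon>" and G: "G \<in> \<Psi>" "Z = cell G \<eta>"
      using Z e h by (auto simp: flag_at_def)
    have "\<eta> \<in> cell F \<epsilon>" using F G center_in_cell[OF h(1)] by blast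
    then have "cell F \<eta> = cell G \<eta>" using cell_recenter F G by metis
    then have "F = G"
      using cell_eqD F(1) G(1) h(1) flag_subset_faces[OF poly] e(2) h(2) by (meson subsetD)
    then have "F \<in> Q" using F G \<open>\<eta> \<in> cell F \<epsilon>\<close> by (simp add: Q_def)
    then show ?thesis using F(2) by (simp add: flag_at_def)
  qed (simp add: flag_at_def)
  then have sub: "X \<inter> Y \<subseteq> flag_at \<epsilon> Q" by blast
  have "(flag_step P (flag_at \<epsilon> Q))\<^sup>*\<^sup>* (flag_at \<epsilon> \<Phi>) (flag_at \<eta> \<Psi>)"
    by (rule P_flag_steps) (use e h in \<open>auto simp: Q_def\<close>)
  then show "(flag_step P (X \<inter> Y))\<^sup>*\<^sup>* X Y"
    unfolding e(3) h(3) by (rule flag_steps_antimono) (use sub e h in blast)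
qed

text \<open>Above the empty face, \<open>Y\<close> is an edge and the faces in between are its two
  endpoints. If \<open>X\<close> is nonempty, centring everything at a point of \<open>X\<close>
  turns the interval into one of \<open>K\<close>, where the diamond condition is known.\<close>

lemma P_diamond: "diamond_condition P"
  unfolding diamond_condition_def face_less_P
proof (intro ballI impI, elim conjE)
  fix X Y assume X: "X \<in> faces P" and Y: "Y \<in> faces P" and XY: "X \<subset> Y"
    and rk: "face_rank P Y = face_rank P X + 2"
  show "card {H \<in> faces P. X \<subset> H \<and> H \<subset> Y} = 2"
  proof (cases "X = {}")
    case True
    obtain \<epsilon> where \<epsilon>: "\<epsilon> \<in> Y" using XY by blast
    then have \<epsilon>c: "\<epsilon> \<in> cube v" using P_subset_cube Y by blast
    obtain F where F: "F \<in> faces K" "Y = cell F \<epsilon>" using face_P_at[OF Y \<epsilon>] .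
    have F0: "face_rank K F = 0" using rk True rank_P_empty rank_P_cell[OF F(1) \<epsilon>c] F(2) by simp
    then have FV: "F \<in> vertices K" using F(1) by (simp add: vertices_def)
    have i: "lab F \<in> {1..v}" using FV lab_image by blast
    obtain L where L: "L \<in> faces K" "face_rank K L = -1" "\<And>G. G \<in> faces K \<Longrightarrow> face_le K L G"
      using polytope_least[OF poly] by blast
    have "{H \<in> faces P. X \<subset> H \<and> H \<subset> Y} = (\<lambda>\<eta>. {\<eta>}) ` Y"
    proof (intro subset_antisym subsetI)
      fix H assume "H \<in> {H \<in> faces P. X \<subset> H \<and> H \<subset> Y}"
      then have H: "H \<in> faces P" "H \<noteq> {}" "H \<subset> Y" using True by auto
      then obtain \<eta> where \<eta>: "\<eta> \<in> H" by blast
      then have \<eta>c: "\<eta> \<in> cube v" using P_subset_cube H by blast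
      obtain G where G: "G \<in> faces K" "H = cell G \<eta>" using face_P_at[OF H(1) \<eta>] .
      have "Y = cell F \<eta>" using F(2) cell_recenter \<eta> H(3) by blast
      then have "face_le K G F" "G \<noteq> F" using H(3) G cell_subset_iff[OF G(1) F(1) \<eta>c] by auto
      then have "face_rank K G = -1"
        using polytope_rank_less[OF poly G(1) F(1)] F0 rank_K_ge[OF G(1)] by simp
      then show "H \<in> (\<lambda>\<eta>. {\<eta>}) ` Y" using cell_least[OF G(1) _ \<eta>c] G(2) \<eta> H(3) by blast
    next
      fix H assume "H \<in> (\<lambda>\<eta>. {\<eta>}) ` Y"
      then obtain \<eta> where \<eta>: "\<eta> \<in> Y" "H = {\<eta>}" by blast
      then have \<eta>c: "\<eta> \<in> cube v" using P_subset_cube Y by blast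
      have "H = cell L \<eta>" using cell_least[OF L(1,2) \<eta>c] \<eta> by simp
      moreover have "Y = cell F \<eta>" using F(2) cell_recenter \<eta> by blast
      moreover have "L \<noteq> F" using L F0 by auto
      ultimately have "H \<subset> Y"
        using cell_subset_iff[OF L(1) F(1) \<eta>c] L(3)[OF F(1)] cell_eqD[OF L(1) F(1) \<eta>c] by blast
      then show "H \<in> {H \<in> faces P. X \<subset> H \<and> H \<subset> Y}"
        using cell_in_P[OF L(1) \<eta>c] \<open>H = cell L \<eta>\<close> \<eta>(2) True by auto
    qed
    \<comment> \<open>The support of the vertex \<open>F\<close> is a single coordinate, so no other
      point is possible.\<close>
    moreover have "Y = {\<epsilon>, flip (lab F) \<epsilon>}"
    proof -
      have "\<eta> = \<epsilon> \<or> \<eta> = flip (lab F) \<epsilon>" if "\<eta> \<in> Y" for \<eta>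
      proof -
        have \<eta>c: "\<eta> \<in> cube v" using that F by (simp add: mem_cell_iff)
        have off: "\<eta> j = \<epsilon> j" if "j \<in> {1..v}" "j \<noteq> lab F" for j
          using \<open>\<eta> \<in> Y\<close> that F(2) support_vertex[OF FV] by (auto simp: mem_cell_iff)
        show ?thesis
        proof (cases "\<eta> (lab F) = \<epsilon> (lab F)")
          case True
          then have "\<eta> = \<epsilon>" using off by (intro cube_eqI[OF \<eta>c \<epsilon>c]) metis
          then show ?thesis ..
        next
          case False
          then have "\<eta> (lab F) = flip (lab F) \<epsilon> (lab F)"
            using cube_value[OF \<eta>c i] cube_value[OF \<epsilon>c i] by (auto simp: flip_def)
          then have "\<eta> = flip (lab F) \<epsilon>"
            using off flip_other by (intro cube_eqI[OF \<eta>c flip_in_cube[OF \<epsilon>c i]]) metis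
          then show ?thesis ..
        qed
      qed
      moreover have "flip (lab F) \<epsilon> \<in> Y"
        using flip_in_cell_iff[OF \<epsilon>c i] support_vertex[OF FV] F(2) by simp
      ultimately show ?thesis using \<epsilon> by blast
    qed
    moreover have "flip (lab F) \<epsilon> \<noteq> \<epsilon>" using flip_neq by metis
    ultimately show ?thesis by (simp add: card_image)
  next
    case False
    then obtain \<epsilon> where \<epsilon>: "\<epsilon> \<in> X" by blast
    then have \<epsilon>c: "\<epsilon> \<in> cube v" using P_subset_cube X by blast
    obtain F where F: "F \<in> faces K" "X = cell F \<epsilon>" using face_P_at[OF X \<epsilon>] .
    obtain G where G: "G \<in> faces K" "Y = cell G \<epsilon>" using face_P_at[OF Y] \<epsilon> XY by blast
    have less: "cell A \<epsilon> \<subset> cell B \<epsilon> \<longleftrightarrow> face_less K A B" if "A \<in> faces K" "B \<in> faces K" for A B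
      using cell_subset_iff[OF that \<epsilon>c] cell_eqD[OF that \<epsilon>c] by (auto simp: face_less_def psubset_eq)
    have "{H \<in> faces P. X \<subset> H \<and> H \<subset> Y} =
      (\<lambda>H. cell H \<epsilon>) ` {H \<in> faces K. face_less K F H \<and> face_less K H G}"
    proof (intro subset_antisym subsetI)
      fix H assume H: "H \<in> {H \<in> faces P. X \<subset> H \<and> H \<subset> Y}"
      then obtain A where "A \<in> faces K" "H = cell A \<epsilon>" using face_P_at[of H \<epsilon>] \<epsilon> by blast
      then show "H \<in> (\<lambda>H. cell H \<epsilon>) ` {H \<in> faces K. face_less K F H \<and> face_less K H G}"
        using H less F G by auto
    next
      fix H assume "H \<in> (\<lambda>H. cell H \<epsilon>) ` {H \<in> faces K. face_less K F H \<and> face_less K H G}"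
      then obtain A where "A \<in> faces K" "H = cell A \<epsilon>" "face_less K F A" "face_less K A G" by blast
      then show "H \<in> {H \<in> faces P. X \<subset> H \<and> H \<subset> Y}"
        using less[of F A] less[of A G] F G cell_in_P[OF _ \<epsilon>c, of A] by simp
    qed
    moreover have "card ((\<lambda>H. cell H \<epsilon>) ` {H \<in> faces K. face_less K F H \<and> face_less K H G}) =
      card {H \<in> faces K. face_less K F H \<and> face_less K H G}"
      by (rule card_image[OF inj_on_subset[OF cell_inj_on[OF \<epsilon>c]]]) blast
    moreover have "card {H \<in> faces K. face_less K F H \<and> face_less K H G} = 2"
      using less[OF F(1) G(1)] XY F G rk rank_P_cell[OF _ \<epsilon>c]
      by (intro polytope_diamond[OF poly]) (auto simp: face_less_def)
    ultimately show ?thesis by simp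
  qed
qed

lemma P_rank_image: "face_rank P ` faces P = {-1..m + 1}"
proof -
  obtain L where "L \<in> faces K" "face_rank K L = -1" using polytope_least[OF poly] by blast
  then have "-1 \<in> {-1..m}" using polytope_rank_image[OF poly] by force
  then have m: "-1 \<le> m" by simp
  have "face_rank P ` faces P = insert (-1) ((\<lambda>r. r + 1) ` face_rank K ` faces K)"
  proof (intro subset_antisym subsetI)
    fix j assume "j \<in> face_rank P ` faces P"
    then show "j \<in> insert (-1) ((\<lambda>r. r + 1) ` face_rank K ` faces K)"
      unfolding faces_P using rank_P_cell rank_P_empty by auto
  next
    fix j assume "j \<in> insert (-1) ((\<lambda>r. r + 1) ` face_rank K ` faces K)"
    then consider "j = -1" | F where "F \<in> faces K" "j = face_rank K F + 1" by blast
    then show "j \<in> face_rank P ` faces P"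
    proof cases
      case 1
      then show ?thesis using rank_P_empty empty_in_P by (metis imageI)
    next
      case 2
      then show ?thesis using rank_P_cell cell_in_P cube_nonempty by (metis imageI)
    qed
  qed
  also have "\<dots> = insert (-1) {0..m + 1}"
    unfolding polytope_rank_image[OF poly] by simp
  also have "\<dots> = {-1..m + 1}" using m by auto
  finally show ?thesis .
qed

lemma P_rank_less:
  assumes "X \<in> faces P" "Y \<in> faces P" "X \<subset> Y"
  shows "face_rank P X < face_rank P Y"
proof -
  \<comment> \<open>The point is taken in \<open>X\<close> whenever possible, so that one centre
    serves both faces.\<close>
  obtain \<epsilon> where \<epsilon>: "\<epsilon> \<in> Y" "X \<noteq> {} \<Longrightarrow> \<epsilon> \<in> X" using assms(3) by blast
  then have \<epsilon>c: "\<epsilon> \<in> cube v" using P_subset_cube assms(2) by blast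
  obtain G where G: "G \<in> faces K" "Y = cell G \<epsilon>" using face_P_at[OF assms(2) \<epsilon>(1)] .
  show ?thesis
  proof (cases "X = {}")
    case True
    then show ?thesis using rank_K_ge[OF G(1)] rank_P_cell[OF G(1) \<epsilon>c] G(2) rank_P_empty by simp
  next
    case False
    then obtain F where F: "F \<in> faces K" "X = cell F \<epsilon>" using face_P_at[OF assms(1)] \<epsilon>(2) by blast
    then have "face_le K F G" "F \<noteq> G" using assms(3) G cell_subset_iff[OF F(1) G(1) \<epsilon>c] by auto
    then show ?thesis
      using polytope_rank_less[OF poly F(1) G(1)] rank_P_cell F G \<epsilon>c by simp
  qed
qed

lemma P_polytope: "abstract_polytope (m + 1) P"
  unfolding abstract_polytope_def
proof (intro conjI)
  show "reflp_on (faces P) (face_le P)" by (rule P_reflp)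
  show "antisymp_on (faces P) (face_le P)" "transp_on (faces P) (face_le P)"
    by (auto simp: face_le_P antisymp_on_def transp_on_def)
  show "monotone_on (faces P) (face_less P) (<) (face_rank P)"
    by (auto simp: monotone_on_def face_less_P P_rank_less)
  show "face_rank P ` faces P = {-1..m + 1}" by (rule P_rank_image)
  show "\<exists>F\<in>faces P. \<forall>G\<in>faces P. face_le P F G"
    using empty_in_P by (auto simp: face_le_P)
  obtain T where T: "T \<in> faces K" "\<And>G. G \<in> faces K \<Longrightarrow> face_le K G T"
    using polytope_greatest[OF poly] by blast
  have "cell T (\<lambda>i\<in>{1..v}. 0) = cube v"
    using support_greatest[OF T(2)] by (auto simp: mem_cell_iff)
  then have "cube v \<in> faces P" using cell_in_P[OF T(1) cube_nonempty] by simp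
  then show "\<exists>F\<in>faces P. \<forall>G\<in>faces P. face_le P G F"
    using P_subset_cube unfolding face_le_P by blast
  show "\<forall>\<Phi>\<in>flags P. int (card \<Phi>) = m + 1 + 2"
    using flag_P_cases card_flag_at by (metis add.assoc numeral_plus_one one_plus_numeral semiring_norm(3) add_One)
qed (rule P_connected P_diamond)+

section \<open>Orbits of flags\<close>

text \<open>Automorphisms are required to respect the order only, so vertices are characterized
  without the rank. Below a vertex there is just the least face; a face of rank at least 1 lies in a
  flag whose vertex and least face are two distinct faces below it.\<close>

lemma vertices_iff_card:
  "x \<in> vertices K \<longleftrightarrow> x \<in> faces K \<and> card {y \<in> faces K. face_less K y x} = 1"
proof (cases "x \<in> faces K")
  case x: True
  obtain L where L: "L \<in> faces K" "face_rank K L = -1" "\<And>G. G \<in> faces K \<Longrightarrow> face_le K L G"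
    using polytope_least[OF poly] by blast
  have "{y \<in> faces K. face_less K y x} = {L}" if "face_rank K x = 0"
  proof -
    have "y = L" if "y \<in> faces K" "face_less K y x" for y
      using polytope_rank_less[OF poly that(1) x] that \<open>face_rank K x = 0\<close> rank_K_ge[OF that(1)]
        comparable_rank_eq[OF poly that(1) L(1)] L
      by (auto simp: face_less_def)
    moreover have "face_less K L x" using L x \<open>face_rank K x = 0\<close> by (auto simp: face_less_def)
    ultimately show ?thesis using L by blast
  qed
  moreover have "face_rank K x = 0" if card1: "card {y \<in> faces K. face_less K y x} = 1"
  proof (rule ccontr)
    assume nz: "face_rank K x \<noteq> 0"
    obtain z where z: "{y \<in> faces K. face_less K y x} = {z}" using card1 card_1_singletonE by blast
    \<comment> \<open>The face \<open>z\<close> below \<open>x\<close> has smaller rank, and no rank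
      is less than -1.\<close>
    have "face_rank K x \<noteq> -1"
      using z polytope_rank_less[OF poly, of z x] x rank_K_ge[of z] by (force simp: face_less_def)
    then have x1: "face_rank K x \<ge> 1" using rank_K_ge[OF x] nz by simp
    have "face_rank K x \<in> {-1..m}" using polytope_rank_image[OF poly] x by blast
    then have m: "1 \<le> m" using x1 by simp
    have "face_chain K {x}" using x polytope_refl[OF poly] by (simp add: face_chain_def)
    then obtain \<Phi> where \<Phi>: "\<Phi> \<in> flags K" "x \<in> \<Phi>"
      using face_chain_extends_to_flag[OF polytope_reflp[OF poly] fin] by blast
    obtain y where y: "y \<in> \<Phi>" "face_rank K y = 0"
      using flag_obtain_rank[OF poly \<Phi>(1), of 0] m by auto
    have yK: "y \<in> faces K" using flag_subset_faces[OF poly \<Phi>(1)] y by blast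
    have "face_le K y x"
      using comparable_rank_le[OF poly yK x] face_chainD[OF flag_face_chain[OF poly \<Phi>(1)]] y \<Phi>(2) x1
      by simp
    then have "face_less K y x" "face_less K L x" using y x1 L x by (auto simp: face_less_def)
    then have "y \<in> {z}" "L \<in> {z}" unfolding z[symmetric] using yK L(1) by simp_all
    then have "y = L" by simp
    then show False using y L by simp
  qed
  ultimately have "face_rank K x = 0 \<longleftrightarrow> card {y \<in> faces K. face_less K y x} = 1" by fastforce
  then show ?thesis using x by (simp add: vertices_def)
qed (simp add: vertices_def)

text \<open>The map \<gamma> matches the faces strictly below \<open>x\<close> with those strictly
  below its image, so the counting criterion for vertices carries over.\<close>

lemma automorphism_vertices:
  assumes \<gamma>: "\<gamma> \<in> automorphisms K"
  shows "bij_betw \<gamma> (vertices K) (vertices K)"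
    and "F \<in> faces K \<Longrightarrow> vertex_set K (\<gamma> F) = \<gamma> ` vertex_set K F"
proof -
  have b: "bij_betw \<gamma> (faces K) (faces K)"
    and le: "\<And>F G. F \<in> faces K \<Longrightarrow> G \<in> faces K \<Longrightarrow> face_le K (\<gamma> F) (\<gamma> G) \<longleftrightarrow> face_le K F G"
    using \<gamma> by (auto simp: automorphisms_def)
  have inj: "inj_on \<gamma> (faces K)" and surj: "\<gamma> ` faces K = faces K"
    using b by (auto simp: bij_betw_def)
  have less: "face_less K (\<gamma> F) (\<gamma> G) \<longleftrightarrow> face_less K F G"
    if "F \<in> faces K" "G \<in> faces K" for F G
    using le[OF that] inj_on_eq_iff[OF inj that] by (simp add: face_less_def)
  have vert: "\<gamma> x \<in> vertices K \<longleftrightarrow> x \<in> vertices K" if x: "x \<in> faces K" for x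
  proof -
    have "{y \<in> faces K. face_less K y (\<gamma> x)} = \<gamma> ` {y \<in> faces K. face_less K y x}"
    proof (intro subset_antisym subsetI)
      fix y assume y: "y \<in> {y \<in> faces K. face_less K y (\<gamma> x)}"
      then obtain z where "z \<in> faces K" "y = \<gamma> z" using surj by blast
      then show "y \<in> \<gamma> ` {y \<in> faces K. face_less K y x}" using y less x by blast
    qed (use less x surj in blast)
    moreover have "card (\<gamma> ` {y \<in> faces K. face_less K y x}) = card {y \<in> faces K. face_less K y x}"
      by (rule card_image[OF inj_on_subset[OF inj]]) blast
    moreover have "\<gamma> x \<in> faces K" using surj x by blast
    ultimately show ?thesis using x by (simp add: vertices_iff_card)
  qed
  have vsub: "vertices K \<subseteq> faces K" by (auto simp: vertices_def)
  have "\<gamma> ` vertices K = vertices K"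
  proof (intro subset_antisym subsetI)
    fix y assume y: "y \<in> vertices K"
    then obtain x where "x \<in> faces K" "y = \<gamma> x" using surj vsub by blast
    then show "y \<in> \<gamma> ` vertices K" using vert y by blast
  qed (use vert vsub in blast)
  then show bv: "bij_betw \<gamma> (vertices K) (vertices K)"
    using inj_on_subset[OF inj vsub] by (simp add: bij_betw_def)
  show "vertex_set K (\<gamma> F) = \<gamma> ` vertex_set K F" if F: "F \<in> faces K"
  proof (intro subset_antisym subsetI)
    fix y assume y: "y \<in> vertex_set K (\<gamma> F)"
    then obtain x where "x \<in> vertices K" "y = \<gamma> x"
      using \<open>\<gamma> ` vertices K = vertices K\<close> by (auto simp: vertex_set_def)
    then show "y \<in> \<gamma> ` vertex_set K F" using y le F vsub by (auto simp: vertex_set_def)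
  next
    fix y assume "y \<in> \<gamma> ` vertex_set K F"
    then show "y \<in> vertex_set K (\<gamma> F)"
      using \<open>\<gamma> ` vertices K = vertices K\<close> le F vsub by (auto simp: vertex_set_def)
  qed
qed

text \<open>An automorphism of \<open>K\<close> permutes the coordinates of the cube; composed with the translation
  taking the image of \<open>\<epsilon>\<close> to \<open>\<eta>\<close> it acts on the faces of \<open>2\<^sup>K\<close>.\<close>

lemma lift_automorphism:
  assumes \<gamma>: "\<gamma> \<in> automorphisms K" and \<epsilon>: "\<epsilon> \<in> cube v" and \<eta>: "\<eta> \<in> cube v"
  obtains \<alpha> where "\<alpha> \<in> automorphisms P" "\<And>\<Phi>. \<Phi> \<subseteq> faces K \<Longrightarrow> \<alpha> ` flag_at \<epsilon> \<Phi> = flag_at \<eta> (\<gamma> ` \<Phi>)"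
proof -
  have bK: "bij_betw \<gamma> (faces K) (faces K)" using \<gamma> by (simp add: automorphisms_def)
  \<comment> \<open>The permutation of coordinates that \<gamma> induces through the
    labelling.\<close>
  define \<pi> where "\<pi> = lab \<circ> \<gamma> \<circ> inv_into (vertices K) lab"
  have \<pi>: "bij_betw \<pi> {1..v} {1..v}"
    unfolding \<pi>_def
    using bij_betw_trans[OF bij_betw_trans[OF bij_betw_inv_into[OF lab] automorphism_vertices(1)[OF \<gamma>]] lab]
    by (simp add: comp_assoc)
  have \<pi>support: "support (\<gamma> F) = \<pi> ` support F" if "F \<in> faces K" for F
  proof -
    have "\<pi> (lab x) = lab (\<gamma> x)" if "x \<in> vertex_set K F" for x
      using inv_into_f_f[OF lab_inj] that by (simp add: \<pi>_def vertex_set_def)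
    then show ?thesis
      unfolding support_def automorphism_vertices(2)[OF \<gamma> that] image_image by simp
  qed
  define \<kappa> where "\<kappa> = inv_into {1..v} \<pi>"
  have \<kappa>: "\<kappa> j \<in> {1..v}" "\<pi> (\<kappa> j) = j" if "j \<in> {1..v}" for j
    using bij_betw_inv_into_right[OF \<pi> that] bij_betw_apply[OF bij_betw_inv_into[OF \<pi>] that]
    by (simp_all add: \<kappa>_def)
  have \<kappa>\<pi>: "\<kappa> (\<pi> i) = i" "\<pi> i \<in> {1..v}" if "i \<in> {1..v}" for i
    using bij_betw_inv_into_left[OF \<pi> that] bij_betw_apply[OF \<pi> that] by (simp_all add: \<kappa>_def)
  \<comment> \<open>Modulo 2 this is \<eta> plus the permuted difference of \<zeta> and \<epsilon>:
    coordinate \<open>j\<close> of \<eta> is switched exactly if \<zeta> and \<epsilon> differ at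
    the coordinate that \<pi> sends to \<open>j\<close>.\<close>
  define g where "g = (\<lambda>\<zeta>. \<lambda>j\<in>{1..v}. if \<zeta> (\<kappa> j) = \<epsilon> (\<kappa> j) then \<eta> j else 1 - \<eta> j)"
  have gc: "g \<zeta> \<in> cube v" for \<zeta>
    using cube_value[OF \<eta>] by (fastforce simp: g_def cube_def)
  \<comment> \<open>The map \<open>g\<close> carries the coordinates in which two points differ
    along \<pi>. This gives both its injectivity and its effect on cells.\<close>
  have agree: "g \<zeta> j = g \<theta> j \<longleftrightarrow> \<zeta> (\<kappa> j) = \<theta> (\<kappa> j)"
    if "\<zeta> \<in> cube v" "\<theta> \<in> cube v" "j \<in> {1..v}" for \<zeta> \<theta> j
    using cube_value[OF that(1) \<kappa>(1)[OF that(3)]] cube_value[OF that(2) \<kappa>(1)[OF that(3)]]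
      cube_value[OF \<epsilon> \<kappa>(1)[OF that(3)]] cube_value[OF \<eta> that(3)] that(3)
    by (auto simp: g_def)
  have g\<epsilon>: "g \<epsilon> = \<eta>"
    by (rule cube_eqI[OF gc \<eta>]) (simp add: g_def)
  have ginj: "inj_on g (cube v)"
  proof (rule inj_onI)
    fix \<zeta> \<theta> assume z: "\<zeta> \<in> cube v" "\<theta> \<in> cube v" "g \<zeta> = g \<theta>"
    have "\<zeta> i = \<theta> i" if "i \<in> {1..v}" for i
      using agree[OF z(1,2) \<kappa>\<pi>(2)[OF that]] \<kappa>\<pi>(1)[OF that] z(3) by simp
    then show "\<zeta> = \<theta>" by (rule cube_eqI[OF z(1,2)])
  qed
  have gsurj: "g ` cube v = cube v"
    by (rule endo_inj_surj[OF finite_cube _ ginj]) (use gc in blast)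
  have g_cell: "g ` cell F \<zeta> = cell (\<gamma> F) (g \<zeta>)" if F: "F \<in> faces K" and \<zeta>: "\<zeta> \<in> cube v" for F \<zeta>
  proof -
    have "g \<theta> \<in> cell (\<gamma> F) (g \<zeta>) \<longleftrightarrow> \<theta> \<in> cell F \<zeta>" if \<theta>: "\<theta> \<in> cube v" for \<theta>
    proof -
      have "g \<theta> \<in> cell (\<gamma> F) (g \<zeta>) \<longleftrightarrow> (\<forall>j\<in>{1..v}. \<theta> (\<kappa> j) \<noteq> \<zeta> (\<kappa> j) \<longrightarrow> j \<in> \<pi> ` support F)"
        using agree[OF \<theta> \<zeta>] gc by (simp add: mem_cell_iff \<pi>support[OF F])
      \<comment> \<open>Substitution of \<open>\<pi> i\<close> for \<open>j\<close>, with inverse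
        \<open>\<kappa> j\<close>.\<close>
      also have "\<dots> \<longleftrightarrow> (\<forall>i\<in>{1..v}. \<theta> i \<noteq> \<zeta> i \<longrightarrow> i \<in> support F)"
        using \<kappa> \<kappa>\<pi> support_subset[of F] by (smt (verit) image_iff subset_iff)
      finally show ?thesis using \<theta> by (simp add: mem_cell_iff)
    qed
    then have "g ` cell F \<zeta> = {\<xi> \<in> g ` cube v. \<xi> \<in> cell (\<gamma> F) (g \<zeta>)}"
      using cell_subset_cube[of F \<zeta>] by blast
    then show ?thesis using cell_subset_cube[of "\<gamma> F" "g \<zeta>"] unfolding gsurj by blast
  qed
  define \<alpha> where "\<alpha> = (\<lambda>X. g ` X)"
  have \<alpha>inj: "inj_on \<alpha> (faces P)"
    unfolding \<alpha>_def by (rule inj_on_subset[OF inj_on_image_Pow[OF ginj]]) (use P_subset_cube in blast)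
  have \<gamma>K: "\<gamma> F \<in> faces K" if "F \<in> faces K" for F using bij_betw_apply[OF bK that] .
  have "\<alpha> X \<in> faces P" if XP: "X \<in> faces P" for X
  proof (cases "X = {}")
    case False
    then obtain F \<zeta> where "F \<in> faces K" "\<zeta> \<in> cube v" "X = cell F \<zeta>"
      using XP unfolding faces_P by blast
    then show ?thesis using g_cell[of F \<zeta>] cell_in_P[OF \<gamma>K gc] by (simp add: \<alpha>_def)
  qed (simp add: \<alpha>_def empty_in_P)
  then have "\<alpha> ` faces P \<subseteq> faces P" by blast
  then have "\<alpha> ` faces P = faces P" by (rule endo_inj_surj[OF finite_faces_P _ \<alpha>inj])
  moreover have "\<alpha> X \<subseteq> \<alpha> Y \<longleftrightarrow> X \<subseteq> Y" if "X \<in> faces P" "Y \<in> faces P" for X Y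
    unfolding \<alpha>_def
    by (rule image_subset_cancel[OF ginj P_subset_cube[OF that(1)] P_subset_cube[OF that(2)]])
  ultimately have "\<alpha> \<in> automorphisms P"
    using \<alpha>inj by (simp add: automorphisms_def bij_betw_def face_le_P)
  moreover have "\<alpha> ` flag_at \<epsilon> \<Phi> = flag_at \<eta> (\<gamma> ` \<Phi>)" if \<Phi>: "\<Phi> \<subseteq> faces K" for \<Phi>
  proof -
    have "\<alpha> (cell F \<epsilon>) = cell (\<gamma> F) \<eta>" if "F \<in> \<Phi>" for F
      using g_cell[OF subsetD[OF \<Phi> that] \<epsilon>] by (simp add: \<alpha>_def g\<epsilon>)
    then show ?thesis by (simp add: flag_at_def image_image) (simp add: \<alpha>_def)
  qed
  ultimately show ?thesis using that by blast
qed

text \<open>The automorphism \<alpha> sends cells through \<epsilon> to cells through \<eta>.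
  Reading off the underlying faces of \<open>K\<close> defines \<gamma>, which is an automorphism
  because inclusion at a common centre is incidence in \<open>K\<close>.\<close>

lemma flag_at_orbitD:
  assumes \<Phi>: "\<Phi> \<in> flags K" and \<Psi>: "\<Psi> \<in> flags K" and \<epsilon>: "\<epsilon> \<in> cube v" and \<eta>: "\<eta> \<in> cube v"
    and \<alpha>: "\<alpha> \<in> automorphisms P" and img: "\<alpha> ` flag_at \<epsilon> \<Phi> = flag_at \<eta> \<Psi>"
  shows "\<Psi> \<in> flag_orbit K \<Phi>"
proof -
  have b: "bij_betw \<alpha> (faces P) (faces P)"
    and le: "\<And>X Y. X \<in> faces P \<Longrightarrow> Y \<in> faces P \<Longrightarrow> \<alpha> X \<subseteq> \<alpha> Y \<longleftrightarrow> X \<subseteq> Y"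
    using \<alpha> by (simp_all add: automorphisms_def face_le_P)
  have surj: "\<alpha> ` faces P = faces P" using b by (simp add: bij_betw_def)
  have sub: "\<Phi> \<subseteq> faces K" "\<Psi> \<subseteq> faces K" using flag_subset_faces[OF poly] \<Phi> \<Psi> by blast+
  obtain E where "E \<in> faces P" "\<alpha> E = {}" using surj empty_in_P by (metis imageE)
  \<comment> \<open>The face mapped to the empty face contains \<open>{}\<close>, so the image of
    \<open>{}\<close> lies below the empty face.\<close>
  then have \<alpha>0: "\<alpha> {} = {}" using le[OF empty_in_P, of E] by simp
  have \<alpha>ne: "\<alpha> X \<noteq> {}" if "X \<in> faces P" "X \<noteq> {}" for X
    using le[OF that(1) empty_in_P] \<alpha>0 that(2) by simp
  obtain L where L: "L \<in> \<Phi>" "L \<in> faces K" "face_rank K L = -1" using least_in_flag[OF \<Phi>] .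
  have cellL: "cell L \<epsilon> = {\<epsilon>}" using cell_least[OF L(2,3) \<epsilon>] .
  have point: "{\<epsilon>} \<in> faces P" using cell_in_P[OF L(2) \<epsilon>] cellL by simp
  have "{\<epsilon>} \<in> flag_at \<epsilon> \<Phi>" using cell_in_flag_at[OF L(1), of \<epsilon>] cellL by simp
  then have "\<alpha> {\<epsilon>} \<in> flag_at \<eta> \<Psi>" using img by blast
  \<comment> \<open>Membership of \<eta> in the image of the vertex suffices: the image of every
    cell through \<epsilon> contains this image and can thus be centred at \<eta>.\<close>
  then have \<eta>mem: "\<eta> \<in> \<alpha> {\<epsilon>}" using center_in_flag_at[OF \<eta>] \<alpha>ne[OF point] by blast
  have ex: "\<exists>G\<in>faces K. \<alpha> (cell F \<epsilon>) = cell G \<eta>" if F: "F \<in> faces K" for F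
  proof -
    have "\<alpha> {\<epsilon>} \<subseteq> \<alpha> (cell F \<epsilon>)" using le[OF point cell_in_P[OF F \<epsilon>]] center_in_cell[OF \<epsilon>] by simp
    moreover have "\<alpha> (cell F \<epsilon>) \<in> faces P" by (rule bij_betw_apply[OF b cell_in_P[OF F \<epsilon>]])
    ultimately show ?thesis using face_P_at \<eta>mem by (metis subsetD)
  qed
  define \<gamma> where "\<gamma> F = (SOME G. G \<in> faces K \<and> \<alpha> (cell F \<epsilon>) = cell G \<eta>)" for F
  have \<gamma>: "\<gamma> F \<in> faces K" "\<alpha> (cell F \<epsilon>) = cell (\<gamma> F) \<eta>" if "F \<in> faces K" for F
    using someI_ex[of "\<lambda>G. G \<in> faces K \<and> \<alpha> (cell F \<epsilon>) = cell G \<eta>"] ex[OF that]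
    unfolding \<gamma>_def by blast+
  have \<gamma>le: "face_le K (\<gamma> F) (\<gamma> G) \<longleftrightarrow> face_le K F G" if "F \<in> faces K" "G \<in> faces K" for F G
    using le[OF cell_in_P[OF that(1) \<epsilon>] cell_in_P[OF that(2) \<epsilon>]] \<gamma> that
      cell_subset_iff[OF _ _ \<epsilon>] cell_subset_iff[OF _ _ \<eta>] by simp
  \<comment> \<open>Preserving and reflecting the order makes \<gamma> injective, and finiteness of
    \<open>K\<close> then makes it onto.\<close>
  have "inj_on \<gamma> (faces K)"
    by (rule inj_onI) (metis \<gamma>le polytope_antisym[OF poly] polytope_refl[OF poly])
  moreover have "\<gamma> ` faces K = faces K"
    by (rule endo_inj_surj[OF fin _ calculation]) (use \<gamma>(1) in blast)
  ultimately have \<gamma>aut: "\<gamma> \<in> automorphisms K"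
    using \<gamma>le by (simp add: automorphisms_def bij_betw_def)
  have "flag_at \<eta> (\<gamma> ` \<Phi>) = flag_at \<eta> \<Psi>"
  proof -
    have "\<alpha> ` flag_at \<epsilon> \<Phi> = flag_at \<eta> (\<gamma> ` \<Phi>)"
      using \<gamma>(2) sub(1) by (auto simp: flag_at_def image_image \<alpha>0 subset_iff intro!: image_cong)
    then show ?thesis using img by simp
  qed
  then have "\<gamma> ` \<Phi> = \<Psi>"
    using flag_at_inj(2)[OF automorphism_image_flag[OF polytope_reflp[OF poly] \<Phi> \<gamma>aut] \<Psi> \<eta> \<eta>] by blast
  then show ?thesis using \<gamma>aut by (auto simp: flag_orbit_def)
qed

section \<open>Comparison of the orbits\<close>

lemma flag_orbit_subset: "\<Phi> \<in> flags K \<Longrightarrow> flag_orbit K \<Phi> \<subseteq> flags K"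
  using automorphism_image_flag[OF polytope_reflp[OF poly]] by (auto simp: flag_orbit_def)

lemma flag_at_in_orbit_iff:
  assumes "\<Phi> \<in> flags K" "\<Psi> \<in> flags K" "\<epsilon> \<in> cube v" "\<eta> \<in> cube v"
  shows "flag_at \<eta> \<Psi> \<in> flag_orbit P (flag_at \<epsilon> \<Phi>) \<longleftrightarrow> \<Psi> \<in> flag_orbit K \<Phi>"
proof
  assume "flag_at \<eta> \<Psi> \<in> flag_orbit P (flag_at \<epsilon> \<Phi>)"
  then obtain \<alpha> where "\<alpha> \<in> automorphisms P" "\<alpha> ` flag_at \<epsilon> \<Phi> = flag_at \<eta> \<Psi>"
    by (auto simp: flag_orbit_def)
  then show "\<Psi> \<in> flag_orbit K \<Phi>" by (rule flag_at_orbitD[OF assms])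
next
  assume "\<Psi> \<in> flag_orbit K \<Phi>"
  then obtain \<gamma> where \<gamma>: "\<gamma> \<in> automorphisms K" "\<Psi> = \<gamma> ` \<Phi>" by (auto simp: flag_orbit_def)
  obtain \<alpha> where "\<alpha> \<in> automorphisms P" "\<alpha> ` flag_at \<epsilon> \<Phi> = flag_at \<eta> \<Psi>"
    using lift_automorphism[OF \<gamma>(1) assms(3,4)] \<gamma>(2) flag_subset_faces[OF poly assms(1)] by metis
  then show "flag_at \<eta> \<Psi> \<in> flag_orbit P (flag_at \<epsilon> \<Phi>)"
    unfolding flag_orbit_def by (metis (mono_tags, lifting) mem_Collect_eq)
qed

text \<open>The orbit of a lifted flag does not depend on the point: it consists of all lifts, at
  all points, of the flags in one orbit of \<open>K\<close>. So \<open>lift\<close> is a bijection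
  between the two sets of orbits.\<close>

lemma flag_orbits_P:
  shows "finite (flag_orbits P) \<longleftrightarrow> finite (flag_orbits K)"
    and "card (flag_orbits P) = card (flag_orbits K)"
proof -
  define lift where "lift A = {flag_at \<epsilon> \<Psi> | \<epsilon> \<Psi>. \<epsilon> \<in> cube v \<and> \<Psi> \<in> A}" for A :: "'a set set"
  have orbit: "flag_orbit P (flag_at \<epsilon> \<Phi>) = lift (flag_orbit K \<Phi>)"
    if "\<Phi> \<in> flags K" "\<epsilon> \<in> cube v" for \<epsilon> \<Phi>
  proof (intro subset_antisym subsetI)
    fix X assume X: "X \<in> flag_orbit P (flag_at \<epsilon> \<Phi>)"
    then have "X \<in> flags P"
      using automorphism_image_flag[OF P_reflp flag_at_flag[OF that]] by (auto simp: flag_orbit_def)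
    then obtain \<eta> \<Psi> where h: "\<eta> \<in> cube v" "\<Psi> \<in> flags K" "X = flag_at \<eta> \<Psi>"
      by (rule flag_P_cases)
    then have "\<Psi> \<in> flag_orbit K \<Phi>" using flag_at_in_orbit_iff[OF that(1) h(2) that(2) h(1)] X by simp
    then show "X \<in> lift (flag_orbit K \<Phi>)" using h unfolding lift_def by blast
  next
    fix X assume "X \<in> lift (flag_orbit K \<Phi>)"
    then obtain \<eta> \<Psi> where h: "\<eta> \<in> cube v" "\<Psi> \<in> flag_orbit K \<Phi>" "X = flag_at \<eta> \<Psi>"
      unfolding lift_def by blast
    then have "\<Psi> \<in> flags K" using flag_orbit_subset[OF that(1)] by blast
    then show "X \<in> flag_orbit P (flag_at \<epsilon> \<Phi>)"
      using flag_at_in_orbit_iff[OF that(1) _ that(2) h(1)] h by simp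
  qed
  have eq: "flag_orbits P = lift ` flag_orbits K"
  proof (intro subset_antisym subsetI)
    fix A assume "A \<in> flag_orbits P"
    then obtain X where X: "X \<in> flags P" "A = flag_orbit P X" by (auto simp: flag_orbits_def)
    obtain \<epsilon> \<Phi> where "\<epsilon> \<in> cube v" "\<Phi> \<in> flags K" "X = flag_at \<epsilon> \<Phi>" using flag_P_cases[OF X(1)] .
    then show "A \<in> lift ` flag_orbits K" using X(2) orbit by (auto simp: flag_orbits_def)
  next
    fix A assume "A \<in> lift ` flag_orbits K"
    then obtain \<Phi> where \<Phi>: "\<Phi> \<in> flags K" "A = lift (flag_orbit K \<Phi>)" by (auto simp: flag_orbits_def)
    then show "A \<in> flag_orbits P"
      using orbit[OF \<Phi>(1) cube_nonempty] flag_at_flag[OF \<Phi>(1) cube_nonempty]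
      unfolding flag_orbits_def by (metis imageI)
  qed
  have "inj_on lift (flag_orbits K)"
  proof (rule inj_onI)
    fix A B assume AB: "A \<in> flag_orbits K" "B \<in> flag_orbits K" "lift A = lift B"
    have sub: "A \<subseteq> flags K" "B \<subseteq> flags K"
      using AB(1,2) flag_orbit_subset by (auto simp: flag_orbits_def)
    \<comment> \<open>The slice at one fixed point recovers a set of flags from its lift, which
      makes \<open>lift\<close> injective.\<close>
    have "C = {\<Psi> \<in> flags K. flag_at (\<lambda>i\<in>{1..v}. 0) \<Psi> \<in> lift C}" if "C \<subseteq> flags K" for C
    proof (intro subset_antisym subsetI)
      fix \<Psi> assume "\<Psi> \<in> C"
      then show "\<Psi> \<in> {\<Psi> \<in> flags K. flag_at (\<lambda>i\<in>{1..v}. 0) \<Psi> \<in> lift C}"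
        using that cube_nonempty unfolding lift_def by blast
    next
      fix \<Psi> assume "\<Psi> \<in> {\<Psi> \<in> flags K. flag_at (\<lambda>i\<in>{1..v}. 0) \<Psi> \<in> lift C}"
      then obtain \<epsilon> \<Omega> where h: "\<Psi> \<in> flags K" "\<epsilon> \<in> cube v" "\<Omega> \<in> C"
        "flag_at (\<lambda>i\<in>{1..v}. 0) \<Psi> = flag_at \<epsilon> \<Omega>"
        unfolding lift_def by blast
      then have "\<Psi> = \<Omega>" using flag_at_inj(2)[OF h(1) _ cube_nonempty h(2,4)] that by blast
      then show "\<Psi> \<in> C" using h(3) by simp
    qed
    then show "A = B" using sub AB(3) by metis
  qed
  then show "finite (flag_orbits P) \<longleftrightarrow> finite (flag_orbits K)"
    "card (flag_orbits P) = card (flag_orbits K)"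
    unfolding eq by (simp_all add: finite_image_iff card_image)
qed

lemma orbit_polytope_P: "orbit_polytope m k K \<Longrightarrow> orbit_polytope (m + 1) k P"
  using P_polytope flag_orbits_P by (simp add: orbit_polytope_def)

section \<open>Adjacent flags and classes\<close>

lemma flag_at_rank_filter:
  assumes "\<Phi> \<subseteq> faces K" "\<epsilon> \<in> cube v"
  shows "{X \<in> flag_at \<epsilon> \<Phi>. face_rank P X \<noteq> i + 1} =
    {X. X = {} \<and> i \<noteq> -2} \<union> (\<lambda>F. cell F \<epsilon>) ` {F \<in> \<Phi>. face_rank K F \<noteq> i}"
  \<comment> \<open>The empty face has rank -1 and is removed exactly when
    \<open>i + 1 = -1\<close>, hence the exception at -2.\<close>
  using assms rank_P_cell[OF _ assms(2)] by (force simp: flag_at_def rank_P_empty)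

text \<open>By uniqueness of the adjacent flag it is enough to compare the faces of the other ranks,
  and the lift at a fixed point only shifts ranks by one.\<close>

lemma adj_flag_P_Suc:
  assumes "\<Phi> \<in> flags K" "\<epsilon> \<in> cube v" "0 \<le> i" "i \<le> m - 1"
  shows "adj_flag P (i + 1) (flag_at \<epsilon> \<Phi>) = flag_at \<epsilon> (adj_flag K i \<Phi>)"
proof (rule adj_flag_eqI[OF P_polytope])
  note adj = adj_flag_props[OF poly assms(1,3,4)]
  show "flag_at \<epsilon> (adj_flag K i \<Phi>) \<in> flags P" by (rule flag_at_flag[OF adj(1) assms(2)])
  show "flag_at \<epsilon> (adj_flag K i \<Phi>) \<noteq> flag_at \<epsilon> \<Phi>"
    using flag_at_inj(2)[OF adj(1) assms(1,2,2)] adj(2) by blast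
  show "{X \<in> flag_at \<epsilon> (adj_flag K i \<Phi>). face_rank P X \<noteq> i + 1} =
      {X \<in> flag_at \<epsilon> \<Phi>. face_rank P X \<noteq> i + 1}"
    unfolding flag_at_rank_filter[OF flag_subset_faces[OF poly adj(1)] assms(2)]
      flag_at_rank_filter[OF flag_subset_faces[OF poly assms(1)] assms(2)] adj(3) ..
qed (use assms flag_at_flag in auto)

text \<open>The point \<eta> is \<epsilon> flipped in the coordinate of the vertex of \<Phi>, and
  the two lifts differ only in their points, which have rank 0. For the orbit it matters that the
  flag of \<open>K\<close> stays the same.\<close>

lemma adj_flag_P_0:
  assumes \<Phi>: "\<Phi> \<in> flags K" and \<epsilon>: "\<epsilon> \<in> cube v" and m: "0 \<le> m"
  obtains \<eta> where "\<eta> \<in> cube v" "adj_flag P 0 (flag_at \<epsilon> \<Phi>) = flag_at \<eta> \<Phi>"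
proof -
  obtain x where x: "x \<in> \<Phi>" "face_rank K x = 0" using flag_obtain_rank[OF poly \<Phi>, of 0] m by auto
  then have xv: "x \<in> vertices K" using flag_subset_faces[OF poly \<Phi>] by (auto simp: vertices_def)
  let ?\<eta> = "flip (lab x) \<epsilon>"
  have \<eta>: "?\<eta> \<in> cube v" using flip_in_cube[OF \<epsilon>] xv lab_image by blast
  note diff = flag_at_flip_diff[OF \<Phi> xv x(1) \<epsilon>]
  obtain L where L: "L \<in> faces K" "face_rank K L = -1" using polytope_least[OF poly] by blast
  have "face_rank P {\<zeta>} = 0" if "\<zeta> \<in> cube v" for \<zeta>
    using rank_P_cell[OF L(1) that] cell_least[OF L that] L(2) by simp
  then have r0: "face_rank P {\<epsilon>} = 0" "face_rank P {?\<eta>} = 0" using \<epsilon> \<eta> by blast+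
  have "adj_flag P 0 (flag_at \<epsilon> \<Phi>) = flag_at ?\<eta> \<Phi>"
  proof (rule adj_flag_eqI[OF P_polytope])
    show "flag_at ?\<eta> \<Phi> \<noteq> flag_at \<epsilon> \<Phi>" using diff(1) by blast
    have "X \<in> flag_at ?\<eta> \<Phi> \<longleftrightarrow> X \<in> flag_at \<epsilon> \<Phi>" if "face_rank P X \<noteq> 0" for X
    proof -
      have "X \<noteq> {\<epsilon>}" "X \<noteq> {?\<eta>}" using that r0 by auto
      then show ?thesis using diff by blast
    qed
    then show "{X \<in> flag_at ?\<eta> \<Phi>. face_rank P X \<noteq> 0} = {X \<in> flag_at \<epsilon> \<Phi>. face_rank P X \<noteq> 0}"
      by blast
  qed (use m flag_at_flag \<Phi> \<epsilon> \<eta> in auto)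
  then show ?thesis using that \<eta> by blast
qed

text \<open>Exchanging the vertex keeps \<Phi> and so stays in the orbit, which puts 0 into the
  class; exchanging a face of positive rank \<open>j\<close> is decided by the index
  \<open>j - 1\<close> in \<open>K\<close>.\<close>

lemma in_class_two_P:
  assumes "in_class_two m I K"
  shows "in_class_two (m + 1) ({0} \<union> {i + 1 | i. i \<in> I}) P"
proof -
  have orb: "orbit_polytope m 2 K" and I: "I \<subseteq> {0..m - 1}"
    and cls: "\<And>\<Phi> i. \<Phi> \<in> flags K \<Longrightarrow> i \<in> {0..m - 1} \<Longrightarrow> adj_flag K i \<Phi> \<in> flag_orbit K \<Phi> \<longleftrightarrow> i \<in> I"
    using assms by (auto simp: in_class_two_def)
  have m: "0 \<le> m" by (rule two_orbit_rank_nonneg[OF poly orb])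
  have "adj_flag P j X \<in> flag_orbit P X \<longleftrightarrow> j \<in> {0} \<union> {i + 1 | i. i \<in> I}"
    if X: "X \<in> flags P" and j: "j \<in> {0..m}" for X j
  proof -
    obtain \<epsilon> \<Phi> where e: "\<epsilon> \<in> cube v" "\<Phi> \<in> flags K" "X = flag_at \<epsilon> \<Phi>" using flag_P_cases[OF X] .
    show ?thesis
    proof (cases "j = 0")
      case True
      obtain \<eta> where \<eta>: "\<eta> \<in> cube v" "adj_flag P 0 X = flag_at \<eta> \<Phi>"
        using adj_flag_P_0[OF e(2,1) m] e(3) by blast
      then have "adj_flag P 0 X \<in> flag_orbit P X"
        using flag_at_in_orbit_iff[OF e(2,2,1) \<eta>(1)] flag_orbit_refl e(3) by auto
      then show ?thesis using True by simp
    next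
      case False
      then have i: "0 \<le> j - 1" "j - 1 \<le> m - 1" using j by auto
      have "adj_flag P j X = flag_at \<epsilon> (adj_flag K (j - 1) \<Phi>)"
        using adj_flag_P_Suc[OF e(2,1) i] e(3) by simp
      then have "adj_flag P j X \<in> flag_orbit P X \<longleftrightarrow> adj_flag K (j - 1) \<Phi> \<in> flag_orbit K \<Phi>"
        using flag_at_in_orbit_iff[OF e(2) adj_flag_props(1)[OF poly e(2) i] e(1,1)] e(3) by simp
      also have "\<dots> \<longleftrightarrow> j - 1 \<in> I" using cls[OF e(2)] i by simp
      also have "\<dots> \<longleftrightarrow> j \<in> {0} \<union> {i + 1 | i. i \<in> I}" using False by force
      finally show ?thesis .
    qed
  qed
  moreover have "{0} \<union> {i + 1 | i. i \<in> I} \<subseteq> {0..m}" using I m by auto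
  ultimately show ?thesis using orbit_polytope_P[OF orb] by (simp add: in_class_two_def)
qed

end

theorem theorem4:
  fixes K :: "'a ranked_poset" and n v :: nat and lab :: "'a \<Rightarrow> nat"
  assumes "abstract_polytope (int n - 1) K"
    and "finite (faces K)"
    and "vertex_describable K"
    and "bij_betw lab (vertices K) {1..v}"
  shows "finite (faces (two_power v lab K)) \<and>
    abstract_polytope (int n) (two_power v lab K) \<and>
    (\<forall>k\<ge>1. orbit_polytope (int n - 1) k K \<longrightarrow> orbit_polytope (int n) k (two_power v lab K)) \<and>
    (regular_polytope (int n - 1) K \<longrightarrow> regular_polytope (int n) (two_power v lab K)) \<and>
    (\<forall>I\<subseteq>{0..int n - 2}. in_class_two (int n - 1) I K \<longrightarrow>
      in_class_two (int n) ({0} \<union> {i + 1 | i. i \<in> I}) (two_power v lab K)) \<and>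
    (chiral_polytope (int n - 1) K \<longrightarrow> in_class_two (int n) {0} (two_power v lab K))"
proof -
  interpret describable_polytope "int n - 1" K v lab
    by (rule describable_polytope.intro[OF assms])
  \<comment> \<open>The locale counts from the rank \<open>m\<close> of \<open>K\<close> and gives
    the power polytope rank \<open>m + 1\<close>; at \<open>m = int n - 1\<close> this becomes
    \<open>int n\<close>.\<close>
  have n: "int n - 1 + 1 = int n" by simp
  note orbits = orbit_polytope_P[unfolded n] and class_two = in_class_two_P[unfolded n]
  have "in_class_two (int n) {0} P" if "chiral_polytope (int n - 1) K"
    using class_two[OF chiral_in_class_two[OF assms(1) that]] by simp
  then show ?thesis
    using finite_faces_P P_polytope[unfolded n] orbits class_two by (auto simp: regular_polytope_def)
qed

end
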